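(* Let $p = 1117901$ (a prime), let $h = 2^{\frac{p-1}{25}} \in \mathbb{F}_p$ (where $2$ is a primitive element of $\mathbb{F}_p$), let $H = \{1, h, h^2, \ldots, h^{24}\}$ be the subgroup of order $25$ of $\mathbb{F}_p^{\times}$, and let $c = 754583 \in \mathbb{F}_p$, which is a quadratic non-residue. Then the subgraph of the Paley graph $P(p)$ induced on the vertex set $H \cup cH$ is a strongly regular graph with parameters $(50, 21, 8, 9)$, and its full automorphism group has order $100$ and is isomorphic to a semidirect product $C_{25} \rtimes C_4$.
   Context: $\mathbb{F}_p$ is the field with $p$ elements and $\mathbb{F}_p^{\times}$ its multiplicative group. For a prime power $q \equiv 1 \pmod 4$, the Paley graph $P(q)$ is the simple undirected graph with vertex set $\mathbb{F}_q$ in which two distinct vertices $x_1, x_2$ are adjacent if and only if $x_1 - x_2$ is a nonzero square in $\mathbb{F}_q$. A strongly regular graph with parameters $(v, k, \lambda, \mu)$ is a graph on $v$ vertices in which every vertex has degree $k$, any two adjacent vertices have exactly $\lambda$ common neighbours, and any two distinct non-adjacent vertices have exactly $\mu$ common neighbours. $C_n$ denotes the cyclic group of order $n$; in $C_{25} \rtimes C_4$ the normal factor is $C_{25}$. *)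

theory Defs
  imports
    "HOL-Number_Theory.Number_Theory"
    "HOL-Algebra.Bij"
    "HOL-Algebra.Elementary_Groups"
    "Graph_Theory.Graph_Theory"
begin

definition nonzero_squares :: "('a, 'b) ring_scheme \<Rightarrow> 'a set" where
  "nonzero_squares R = {y \<otimes>\<^bsub>R\<^esub> y | y. y \<in> carrier R} - {\<zero>\<^bsub>R\<^esub>}"

text \<open>
  Undirected simple graphs are modelled, as in the locale \<^locale>\<open>graph\<close>, by finite symmetric
  digraphs without loops and parallel arcs. The definition below is meant for a finite field whose
  order is congruent to 1 modulo 4, so that -1 is a square and adjacency is symmetric.
\<close>

definition paley_graph :: "('a, 'b) ring_scheme \<Rightarrow> ('a, 'a \<times> 'a) pre_digraph" where
  "paley_graph R = with_proj
     \<lparr> pverts = carrier R,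
       parcs = {(x, y). x \<in> carrier R \<and> y \<in> carrier R \<and> x \<noteq> y \<and>
                        x \<ominus>\<^bsub>R\<^esub> y \<in> nonzero_squares R} \<rparr>"

definition common_neighbours :: "('a, 'b) pre_digraph \<Rightarrow> 'a \<Rightarrow> 'a \<Rightarrow> 'a set" where
  "common_neighbours G u v = {w \<in> verts G. u \<rightarrow>\<^bsub>G\<^esub> w \<and> v \<rightarrow>\<^bsub>G\<^esub> w}"

definition strongly_regular :: "('a, 'b) pre_digraph \<Rightarrow> nat \<Rightarrow> nat \<Rightarrow> nat \<Rightarrow> nat \<Rightarrow> bool" where
  "strongly_regular G n k l m \<longleftrightarrow>
     graph G \<and>
     card (verts G) = n \<and>
     (\<forall>u \<in> verts G. card {w \<in> verts G. u \<rightarrow>\<^bsub>G\<^esub> w} = k) \<and>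
     (\<forall>u \<in> verts G. \<forall>v \<in> verts G. u \<rightarrow>\<^bsub>G\<^esub> v \<longrightarrow> card (common_neighbours G u v) = l) \<and>
     (\<forall>u \<in> verts G. \<forall>v \<in> verts G. u \<noteq> v \<and> \<not> u \<rightarrow>\<^bsub>G\<^esub> v \<longrightarrow>
        card (common_neighbours G u v) = m)"

text \<open>
  As in \<^const>\<open>AutoGroup\<close>, automorphisms are taken to be extensional, so that a
  permutation of the vertices is counted only once.
\<close>

definition graph_autos :: "('a, 'b) pre_digraph \<Rightarrow> ('a \<Rightarrow> 'a) set" where
  "graph_autos G =
     {f \<in> Bij (verts G). \<forall>u \<in> verts G. \<forall>v \<in> verts G. f u \<rightarrow>\<^bsub>G\<^esub> f v \<longleftrightarrow> u \<rightarrow>\<^bsub>G\<^esub> v}"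

definition graph_AutoGroup :: "('a, 'b) pre_digraph \<Rightarrow> ('a \<Rightarrow> 'a) monoid" where
  "graph_AutoGroup G = BijGroup (verts G) \<lparr>carrier := graph_autos G\<rparr>"

lemma group_graph_AutoGroup: "group (graph_AutoGroup G)"
proof -
  let ?B = "BijGroup (verts G)"
  have "subgroup (graph_autos G) ?B"
  proof (rule subgroup.intro)
    show "graph_autos G \<subseteq> carrier ?B"
      by (auto simp: graph_autos_def BijGroup_def)
    show "\<one>\<^bsub>?B\<^esub> \<in> graph_autos G"
      by (auto simp: graph_autos_def BijGroup_def id_Bij)
    show "f \<otimes>\<^bsub>?B\<^esub> g \<in> graph_autos G" if f: "f \<in> graph_autos G" and g: "g \<in> graph_autos G" for f g
    proof -
      have "g u \<in> verts G" if "u \<in> verts G" for u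
        using g that by (auto simp: graph_autos_def dest: Bij_imp_funcset)
      with f g show ?thesis
        by (simp add: graph_autos_def BijGroup_def compose_Bij) (simp add: compose_def)
    qed
    show "inv\<^bsub>?B\<^esub> f \<in> graph_autos G" if f: "f \<in> graph_autos G" for f
    proof -
      let ?g = "inv_into (verts G) f"
      have B: "f \<in> Bij (verts G)"
        and adj: "\<And>u v. u \<in> verts G \<Longrightarrow> v \<in> verts G \<Longrightarrow> f u \<rightarrow>\<^bsub>G\<^esub> f v \<longleftrightarrow> u \<rightarrow>\<^bsub>G\<^esub> v"
        using f by (auto simp: graph_autos_def)
      have *: "?g u \<in> verts G" "f (?g u) = u" if "u \<in> verts G" for u
        using B that by (auto simp: Bij_def bij_betw_def inv_into_into f_inv_into_f)
      have "?g u \<rightarrow>\<^bsub>G\<^esub> ?g v \<longleftrightarrow> u \<rightarrow>\<^bsub>G\<^esub> v" if "u \<in> verts G" "v \<in> verts G" for u v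
        using adj[of "?g u" "?g v"] * that by simp
      then show ?thesis
        using B by (simp add: graph_autos_def inv_BijGroup restrict_inv_into_Bij)
    qed
  qed
  then show ?thesis
    unfolding graph_AutoGroup_def by (rule subgroup.subgroup_is_group) (rule group_BijGroup)
qed

definition semidirect_product ::
    "('a, 'c) monoid_scheme \<Rightarrow> ('b, 'd) monoid_scheme \<Rightarrow> ('b \<Rightarrow> 'a \<Rightarrow> 'a) \<Rightarrow> ('a \<times> 'b) monoid" where
  "semidirect_product N K \<phi> =
     \<lparr> carrier = carrier N \<times> carrier K,
       monoid.mult = (\<lambda>(n, k) (n', k'). (n \<otimes>\<^bsub>N\<^esub> \<phi> k n', k \<otimes>\<^bsub>K\<^esub> k')),
       one = (\<one>\<^bsub>N\<^esub>, \<one>\<^bsub>K\<^esub>) \<rparr>"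

lemma group_semidirect_product:
  assumes N: "group N" and K: "group K" and \<phi>: "\<phi> \<in> hom K (AutoGroup N)"
  shows "group (semidirect_product N K \<phi>)"
proof -
  interpret N: group N by (rule N)
  interpret K: group K by (rule K)
  interpret A: group "AutoGroup N" by (rule N.AutoGroup)
  interpret \<phi>: group_hom K "AutoGroup N" \<phi>
    using \<phi> by unfold_locales
  have auto: "\<phi> k \<in> auto N" if "k \<in> carrier K" for k
    using \<phi>.hom_closed[OF that] by (simp add: AutoGroup_def)
  have bij: "\<phi> k \<in> Bij (carrier N)" if "k \<in> carrier K" for k
    using auto[OF that] by (simp add: auto_def)
  have cl: "\<phi> k n \<in> carrier N" if "k \<in> carrier K" "n \<in> carrier N" for k n
    using auto[OF that(1)] that(2) by (auto simp: auto_def hom_def)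
  have mult: "\<phi> k (n \<otimes>\<^bsub>N\<^esub> n') = \<phi> k n \<otimes>\<^bsub>N\<^esub> \<phi> k n'"
    if "k \<in> carrier K" "n \<in> carrier N" "n' \<in> carrier N" for k n n'
    using auto[OF that(1)] that(2,3) by (auto simp: auto_def hom_def)
  have comp: "\<phi> (k \<otimes>\<^bsub>K\<^esub> k') n = \<phi> k (\<phi> k' n)"
    if "k \<in> carrier K" "k' \<in> carrier K" "n \<in> carrier N" for k k' n
    using that bij by (simp add: AutoGroup_def BijGroup_def compose_def)
  have one: "\<phi> \<one>\<^bsub>K\<^esub> n = n" if "n \<in> carrier N" for n
    using \<phi>.hom_one that by (simp add: AutoGroup_def BijGroup_def)
  show ?thesis
  proof (rule groupI)
    fix x assume "x \<in> carrier (semidirect_product N K \<phi>)"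
    then obtain n k where x: "x = (n, k)" "n \<in> carrier N" "k \<in> carrier K"
      by (auto simp: semidirect_product_def)
    let ?y = "(\<phi> (inv\<^bsub>K\<^esub> k) (inv\<^bsub>N\<^esub> n), inv\<^bsub>K\<^esub> k)"
    have k': "inv\<^bsub>K\<^esub> k \<in> carrier K" using x by simp
    have "\<phi> (inv\<^bsub>K\<^esub> k) \<one>\<^bsub>N\<^esub> \<otimes>\<^bsub>N\<^esub> \<phi> (inv\<^bsub>K\<^esub> k) \<one>\<^bsub>N\<^esub> = \<phi> (inv\<^bsub>K\<^esub> k) \<one>\<^bsub>N\<^esub>"
      using mult[OF k' N.one_closed N.one_closed] by simp
    then have "\<phi> (inv\<^bsub>K\<^esub> k) \<one>\<^bsub>N\<^esub> = \<one>\<^bsub>N\<^esub>"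
      using cl[OF k' N.one_closed] N.l_cancel_one' by metis
    moreover have "\<phi> (inv\<^bsub>K\<^esub> k) (inv\<^bsub>N\<^esub> n) \<otimes>\<^bsub>N\<^esub> \<phi> (inv\<^bsub>K\<^esub> k) n = \<phi> (inv\<^bsub>K\<^esub> k) \<one>\<^bsub>N\<^esub>"
      using mult[OF k' _ x(2), of "inv\<^bsub>N\<^esub> n"] x by simp
    ultimately have "?y \<otimes>\<^bsub>semidirect_product N K \<phi>\<^esub> x = \<one>\<^bsub>semidirect_product N K \<phi>\<^esub>"
      using x by (simp add: semidirect_product_def del: \<phi>.hom_inv)
    moreover have "?y \<in> carrier (semidirect_product N K \<phi>)"
      using x cl[OF k'] by (simp add: semidirect_product_def del: \<phi>.hom_inv)
    ultimately show "\<exists>y \<in> carrier (semidirect_product N K \<phi>).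
        y \<otimes>\<^bsub>semidirect_product N K \<phi>\<^esub> x = \<one>\<^bsub>semidirect_product N K \<phi>\<^esub>" by blast
  qed (auto simp: semidirect_product_def cl mult comp one N.m_assoc K.m_assoc
        simp del: \<phi>.hom_mult \<phi>.hom_one)
qed

end

theory Submission
  imports Defs
begin

text \<open>
  Write \<open>g = c h\<^sup>5\<close> and label \<open>h\<^sup>i\<close> by \<open>(False, i)\<close> and \<open>g h\<^sup>i\<close> by \<open>(True, i)\<close>, with \<open>i\<close> modulo 25.
  The element \<open>h\<close> is a square, so whether the difference of two of these vertices is a square depends
  only on the two cosets and on the difference of the exponents modulo 25: the graph is a
  bicirculant, given by the set \<open>A = {\<plusminus>2, \<plusminus>3, \<plusminus>5, \<plusminus>6, \<plusminus>7, \<plusminus>12}\<close> inside \<open>H\<close>, a set \<open>B\<close> inside \<open>c H\<close>, and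
  \<open>C = {0, \<plusminus>3, \<plusminus>4, \<plusminus>6, \<plusminus>8}\<close> between the cosets. Reading these sets off means finding 49 Legendre
  symbols modulo 1117901 (\<open>legendre_vertex_diff\<close>). The shift by 5 in the second coset makes the symmetry
  visible: \<open>B = 7 A\<close>, \<open>A = 7 B\<close> and \<open>C = 7 C\<close>, and 7 has order 4 modulo 25. Hence the maps
  that send \<open>i\<close> to \<open>7\<^sup>k i + n\<close> and exchange the cosets when \<open>k\<close> is odd are automorphisms. They form a
  semidirect product of \<open>C\<^sub>2\<^sub>5\<close> by \<open>C\<^sub>4\<close> that is transitive on vertices, so strong regularity only has to be checked at the
  vertex \<open>(False, 0)\<close>.

  There are no other automorphisms (\<open>bicirculant_automorphism_is_affine\<close>). Any two adjacent vertices have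
  8 common neighbours, but the number of edges among these varies. It equals 7
  exactly when the two vertices are \<open>(False, i)\<close> and \<open>(False, i \<plusminus> 2)\<close>, or \<open>(True, i)\<close> and
  \<open>(True, i \<plusminus> 14)\<close>. As 2 and 14 are prime to 25, such edges form two disjoint cycles of length 25, one on each
  coset, and every automorphism preserves this pair of cycles. An automorphism that fixes \<open>(False, 0)\<close> and
  \<open>(False, 2)\<close> therefore fixes the first cycle pointwise, and then every vertex of the other coset,
  since such a vertex is determined by its neighbours on the first cycle. The affine maps already carry
  these two vertices to every pair that an automorphism could carry them to.
\<close>

section \<open>Isomorphic graphs\<close>

definition graph_iso ::
    "('a \<Rightarrow> 'b) \<Rightarrow> ('a, 'c) pre_digraph \<Rightarrow> ('b, 'd) pre_digraph \<Rightarrow> bool" where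
  "graph_iso f G H \<longleftrightarrow> bij_betw f (verts G) (verts H) \<and>
     (\<forall>u \<in> verts G. \<forall>v \<in> verts G. f u \<rightarrow>\<^bsub>H\<^esub> f v \<longleftrightarrow> u \<rightarrow>\<^bsub>G\<^esub> v)"

text \<open>
  Arcs are ordered pairs, so every edge is counted twice.
\<close>

definition arcs_among :: "('a, 'b) pre_digraph \<Rightarrow> 'a set \<Rightarrow> nat" where
  "arcs_among G S = card {(w, z) \<in> S \<times> S. w \<rightarrow>\<^bsub>G\<^esub> z}"

lemma graph_iso_bij: "graph_iso f G H \<Longrightarrow> bij_betw f (verts G) (verts H)"
  by (simp add: graph_iso_def)

lemma graph_iso_in_verts: "graph_iso f G H \<Longrightarrow> u \<in> verts G \<Longrightarrow> f u \<in> verts H"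
  by (auto dest: graph_iso_bij bij_betwE)

lemma graph_iso_adj:
  "graph_iso f G H \<Longrightarrow> u \<in> verts G \<Longrightarrow> v \<in> verts G \<Longrightarrow> f u \<rightarrow>\<^bsub>H\<^esub> f v \<longleftrightarrow> u \<rightarrow>\<^bsub>G\<^esub> v"
  by (simp add: graph_iso_def)

lemma graph_iso_eq_iff:
  "graph_iso f G H \<Longrightarrow> u \<in> verts G \<Longrightarrow> v \<in> verts G \<Longrightarrow> f u = f v \<longleftrightarrow> u = v"
  by (auto dest!: graph_iso_bij bij_betw_imp_inj_on dest: inj_onD)

lemma graph_iso_comp: "graph_iso f G H \<Longrightarrow> graph_iso g H K \<Longrightarrow> graph_iso (g \<circ> f) G K"
  unfolding graph_iso_def by (auto intro: bij_betw_trans dest: bij_betwE)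

lemma graph_iso_cong:
  assumes "graph_iso f G H" "\<And>v. v \<in> verts G \<Longrightarrow> f v = g v"
  shows "graph_iso g G H"
  using assms bij_betw_cong[of "verts G" f g "verts H"] unfolding graph_iso_def by auto

lemma graph_iso_inv:
  assumes "graph_iso f G H"
  shows "graph_iso (inv_into (verts G) f) H G"
proof -
  have b: "bij_betw f (verts G) (verts H)"
    by (rule graph_iso_bij[OF assms])
  have "inv_into (verts G) f u \<in> verts G" "f (inv_into (verts G) f u) = u" if "u \<in> verts H" for u
    using b that by (auto simp: bij_betw_def inv_into_into f_inv_into_f)
  then show ?thesis
    unfolding graph_iso_def by (metis b bij_betw_inv_into graph_iso_adj[OF assms])
qed

lemma graph_autos_iff: "f \<in> graph_autos G \<longleftrightarrow> f \<in> extensional (verts G) \<and> graph_iso f G G"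
  by (auto simp: graph_autos_def Bij_def graph_iso_def)

lemma common_neighbours_iso:
  assumes f: "graph_iso f G H" and uv: "u \<in> verts G" "v \<in> verts G"
  shows "common_neighbours H (f u) (f v) = f ` common_neighbours G u v"
proof
  show "f ` common_neighbours G u v \<subseteq> common_neighbours H (f u) (f v)"
    using f uv by (auto simp: common_neighbours_def graph_iso_adj graph_iso_in_verts)
  show "common_neighbours H (f u) (f v) \<subseteq> f ` common_neighbours G u v"
  proof
    fix y assume y: "y \<in> common_neighbours H (f u) (f v)"
    moreover then obtain w where "w \<in> verts G" "y = f w"
      using graph_iso_bij[OF f] by (auto simp: common_neighbours_def bij_betw_def)
    ultimately show "y \<in> f ` common_neighbours G u v"
      using f uv by (auto simp: common_neighbours_def graph_iso_adj)
  qed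
qed

lemma inj_on_graph_iso: "graph_iso f G H \<Longrightarrow> S \<subseteq> verts G \<Longrightarrow> inj_on f S"
  by (blast intro: inj_on_subset bij_betw_imp_inj_on graph_iso_bij)

lemma card_common_neighbours_iso:
  assumes "graph_iso f G H" "u \<in> verts G" "v \<in> verts G"
  shows "card (common_neighbours H (f u) (f v)) = card (common_neighbours G u v)"
  unfolding common_neighbours_iso[OF assms]
  by (rule card_image, rule inj_on_graph_iso[OF assms(1)]) (auto simp: common_neighbours_def)

lemma arcs_among_iso:
  assumes f: "graph_iso f G H" and S: "S \<subseteq> verts G"
  shows "arcs_among H (f ` S) = arcs_among G S"
proof -
  have "{(w, z) \<in> f ` S \<times> f ` S. w \<rightarrow>\<^bsub>H\<^esub> z} = map_prod f f ` {(w, z) \<in> S \<times> S. w \<rightarrow>\<^bsub>G\<^esub> z}"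
    using S by (auto simp: graph_iso_adj[OF f] subset_iff image_iff Bex_def) 
  moreover have "inj_on (map_prod f f) {(w, z) \<in> S \<times> S. w \<rightarrow>\<^bsub>G\<^esub> z}"
    using inj_on_graph_iso[OF f S] by (auto simp: inj_on_def)
  ultimately show ?thesis
    by (simp add: arcs_among_def card_image)
qed

lemma neighbours_conv_common_neighbours: "{w \<in> verts G. u \<rightarrow>\<^bsub>G\<^esub> w} = common_neighbours G u u"
  by (auto simp: common_neighbours_def)

lemma strongly_regular_iso:
  assumes f: "graph_iso f G H" and H: "graph H" and G: "strongly_regular G n k l m"
  shows "strongly_regular H n k l m"
proof -
  have "verts H = f ` verts G"
    using graph_iso_bij[OF f] by (simp add: bij_betw_def)
  then have all: "(\<forall>u \<in> verts H. P u) \<longleftrightarrow> (\<forall>u \<in> verts G. P (f u))" for P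
    by simp
  have "card (verts H) = card (verts G)"
    using bij_betw_same_card[OF graph_iso_bij[OF f]] by simp
  with G H show ?thesis
    unfolding strongly_regular_def neighbours_conv_common_neighbours all
    by (simp add: graph_iso_adj[OF f] graph_iso_eq_iff[OF f] card_common_neighbours_iso[OF f])
qed

text \<open>
  In a vertex-transitive graph all parameters can be read off at one vertex.
\<close>

lemma strongly_regular_transitiveI:
  assumes G: "graph G" "card (verts G) = n" and x: "x \<in> verts G"
    and trans: "\<And>u. u \<in> verts G \<Longrightarrow> \<exists>f. graph_iso f G G \<and> f x = u"
    and deg: "card (common_neighbours G x x) = k"
    and adj: "\<And>v. v \<in> verts G \<Longrightarrow> x \<rightarrow>\<^bsub>G\<^esub> v \<Longrightarrow> card (common_neighbours G x v) = l"
    and nadj: "\<And>v. v \<in> verts G \<Longrightarrow> x \<noteq> v \<Longrightarrow> \<not> x \<rightarrow>\<^bsub>G\<^esub> v \<Longrightarrow> card (common_neighbours G x v) = m"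
  shows "strongly_regular G n k l m"
proof -
  have "card (common_neighbours G u u) = k" if u: "u \<in> verts G" for u
    using trans[OF u] card_common_neighbours_iso[of _ G G x x] x deg by metis
  moreover have "card (common_neighbours G u v) = (if u \<rightarrow>\<^bsub>G\<^esub> v then l else m)"
    if uv: "u \<in> verts G" "v \<in> verts G" "u \<noteq> v" for u v
  proof -
    obtain f where f: "graph_iso f G G" "f x = u"
      using trans[OF uv(1)] by blast
    have "v \<in> f ` verts G"
      using graph_iso_bij[OF f(1)] uv(2) by (simp add: bij_betw_def)
    then obtain w where w: "w \<in> verts G" "f w = v"
      by blast
    have "x \<noteq> w"
      using f w uv by auto
    then have "card (common_neighbours G x w) = (if x \<rightarrow>\<^bsub>G\<^esub> w then l else m)"
      using w adj nadj by simp
    then show ?thesis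
      using card_common_neighbours_iso[OF f(1) x w(1)] graph_iso_adj[OF f(1) x w(1)] f w by simp
  qed
  moreover have "\<not> u \<rightarrow>\<^bsub>G\<^esub> u" for u
    using G(1) loopfree_digraph.adj_not_same by (auto simp: graph_def digraph_def)
  ultimately show ?thesis
    using G unfolding strongly_regular_def neighbours_conv_common_neighbours by metis
qed

text \<open>
  Conjugation by an isomorphism. The conjugates are restricted to the vertex set because
  automorphisms are extensional.
\<close>

lemma graph_AutoGroup_iso:
  assumes f: "graph_iso f G H"
  shows "graph_AutoGroup G \<cong> graph_AutoGroup H"
proof -
  define f' where "f' = inv_into (verts G) f"
  have f'_iso: "graph_iso f' H G"
    unfolding f'_def by (rule graph_iso_inv[OF f])
  have f'f: "f' (f u) = u" if "u \<in> verts G" for u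
    using graph_iso_bij[OF f] that by (simp add: f'_def bij_betw_inv_into_left)
  have ff': "f (f' u) = u" if "u \<in> verts H" for u
    using graph_iso_bij[OF f] that by (simp add: f'_def bij_betw_inv_into_right)
  note in_H = graph_iso_in_verts[OF f] and in_G = graph_iso_in_verts[OF f'_iso]
  define conj where "conj a = restrict (f \<circ> a \<circ> f') (verts H)" for a
  have conj_auto: "conj a \<in> graph_autos H" if "a \<in> graph_autos G" for a
  proof -
    have "graph_iso (f \<circ> a \<circ> f') H H"
      using that f f'_iso by (auto simp: graph_autos_iff o_assoc intro!: graph_iso_comp)
    then show ?thesis
      by (auto simp: graph_autos_iff conj_def intro: graph_iso_cong)
  qed
  have auto_in: "a u \<in> verts G" if "a \<in> graph_autos G" "u \<in> verts G" for a u
    using that by (auto simp: graph_autos_iff dest: graph_iso_in_verts)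
  have inj: "inj_on conj (graph_autos G)"
  proof (rule inj_onI)
    fix a b assume a: "a \<in> graph_autos G" and b: "b \<in> graph_autos G" and ab: "conj a = conj b"
    have "a u = b u" if u: "u \<in> verts G" for u
    proof -
      have "f (a u) = f (b u)"
        using fun_cong[OF ab, of "f u"] in_H[OF u] by (simp add: conj_def f'f[OF u])
      then show ?thesis
        using graph_iso_eq_iff[OF f] auto_in a b u by simp
    qed
    then show "a = b"
      using a b by (auto simp: graph_autos_iff intro: extensionalityI)
  qed
  have surj: "g \<in> conj ` graph_autos G" if g: "g \<in> graph_autos H" for g
  proof
    define a where "a = restrict (f' \<circ> g \<circ> f) (verts G)"
    have g_in: "g u \<in> verts H" if "u \<in> verts H" for u
      using g that by (auto simp: graph_autos_iff dest: graph_iso_in_verts)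
    have "graph_iso (f' \<circ> g \<circ> f) G G"
      using g f f'_iso by (auto simp: graph_autos_iff o_assoc intro!: graph_iso_comp)
    then show "a \<in> graph_autos G"
      by (auto simp: graph_autos_iff a_def intro: graph_iso_cong)
    show "g = conj a"
    proof (rule extensionalityI[of _ "verts H"])
      show "g \<in> extensional (verts H)" using g by (simp add: graph_autos_iff)
      show "conj a \<in> extensional (verts H)" by (simp add: conj_def)
      show "g u = conj a u" if "u \<in> verts H" for u
        using that g_in by (simp add: conj_def a_def in_G ff')
    qed
  qed
  have bij: "bij_betw conj (graph_autos G) (graph_autos H)"
    using conj_auto inj surj by (auto simp: bij_betw_def)
  have "conj (compose (verts G) a b) = compose (verts H) (conj a) (conj b)"
    if "a \<in> graph_autos G" "b \<in> graph_autos G" for a b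
    using auto_in that in_H in_G f'f by (auto simp: conj_def compose_def fun_eq_iff)
  then have "conj \<in> iso (graph_AutoGroup G) (graph_AutoGroup H)"
    using bij conj_auto
    by (intro isoI homI) (auto simp: graph_AutoGroup_def BijGroup_def graph_autos_def)
  then show ?thesis
    by (auto simp: is_iso_def)
qed

section \<open>A bicirculant graph\<close>

text \<open>
  The Boolean component of a vertex names its coset (\<open>False\<close> for \<open>H\<close>), the integer component is the
  exponent modulo 25.
\<close>

definition connection_set :: "bool \<Rightarrow> bool \<Rightarrow> int set" where
  "connection_set s t =
     (if s \<noteq> t then {0, 3, 4, 6, 8, 17, 19, 21, 22}
      else if s then {1, 4, 8, 9, 10, 11, 14, 15, 16, 17, 21, 24}
      else {2, 3, 5, 6, 7, 12, 13, 18, 19, 20, 22, 23})"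

definition link :: "bool \<Rightarrow> bool \<Rightarrow> int \<Rightarrow> bool" where
  "link s t d \<longleftrightarrow> d mod 25 \<in> connection_set s t"

fun adj :: "bool \<times> int \<Rightarrow> bool \<times> int \<Rightarrow> bool" where
  "adj (s, i) (t, j) \<longleftrightarrow> link s t (j - i)"

definition bicirculant :: "(bool \<times> int, (bool \<times> int) \<times> (bool \<times> int)) pre_digraph" where
  "bicirculant = with_proj
     \<lparr> pverts = UNIV \<times> {0..<25},
       parcs = {(u, v). u \<in> UNIV \<times> {0..<25} \<and> v \<in> UNIV \<times> {0..<25} \<and> adj u v} \<rparr>"

lemma link_cong: "d mod 25 = e mod 25 \<Longrightarrow> link s t d \<longleftrightarrow> link s t e"
  by (simp add: link_def)

lemma mod_25_in_upto: "d mod 25 \<in> set [0..24]" for d :: int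
  by simp

text \<open>
  The exponents of two vertices lie between 0 and 24, so their difference lies between -24 and 24.
  Tabulating \<open>link\<close> on that range spares the larger computations below any reduction modulo 25.
\<close>

lemma link_all: "\<forall>d \<in> set [-24..24]. link s t d \<longleftrightarrow> d mod 25 \<in> connection_set s t"
  by (simp add: link_def)

lemmas link_table =
  link_all[where s = False and t = False, simplified upto_rec1 connection_set_def, simplified]
  link_all[where s = False and t = True, simplified upto_rec1 connection_set_def, simplified]
  link_all[where s = True and t = False, simplified upto_rec1 connection_set_def, simplified]
  link_all[where s = True and t = True, simplified upto_rec1 connection_set_def, simplified]

lemma link_sym: "link t s (- d) \<longleftrightarrow> link s t d"
proof -
  have "\<forall>d \<in> set [0..24]. link t s (- d) \<longleftrightarrow> link s t d"
    by (cases s; cases t; simp add: upto_rec1 link_table)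
  then have "link t s (- (d mod 25)) \<longleftrightarrow> link s t (d mod 25)"
    using mod_25_in_upto by blast
  then show ?thesis
    by (simp add: link_def mod_minus_eq)
qed

lemma link_not_self: "\<not> link s s 0"
  by (cases s; simp add: link_table)

text \<open>
  This is the extra symmetry of the graph: multiplication by 7 exchanges the connection sets of the
  two cosets and maps the one between them to itself.
\<close>

lemma link_times_7: "link (\<not> s) (\<not> t) (7 * d) \<longleftrightarrow> link s t d"
proof -
  have "\<forall>d \<in> set [0..24]. link (\<not> s) (\<not> t) (7 * d) \<longleftrightarrow> link s t d"
    by (cases s; cases t; simp add: upto_rec1 link_def connection_set_def)
  then have "link (\<not> s) (\<not> t) (7 * (d mod 25)) \<longleftrightarrow> link s t (d mod 25)"
    using mod_25_in_upto by blast
  then show ?thesis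
    by (simp add: link_def mod_mult_right_eq)
qed

lemma link_times_7_power: "link (s \<noteq> odd k) (t \<noteq> odd k) (7 ^ k * d) \<longleftrightarrow> link s t d"
proof (induction k)
  case (Suc k)
  have "link (s \<noteq> odd (Suc k)) (t \<noteq> odd (Suc k)) (7 ^ Suc k * d) \<longleftrightarrow>
      link (\<not> (s \<noteq> odd k)) (\<not> (t \<noteq> odd k)) (7 * (7 ^ k * d))"
    by (simp add: mult.assoc)
  with Suc show ?case
    by (simp only: link_times_7)
qed simp

lemma verts_bicirculant: "verts bicirculant = UNIV \<times> {0..<25}"
  by (simp add: bicirculant_def)

lemma bicirculant_adj:
  "u \<rightarrow>\<^bsub>bicirculant\<^esub> v \<longleftrightarrow> u \<in> verts bicirculant \<and> v \<in> verts bicirculant \<and> adj u v"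
  by (simp add: bicirculant_def)

lemma graph_with_proj:
  assumes "finite V" "\<And>u v. (u, v) \<in> A \<Longrightarrow> u \<in> V \<and> v \<in> V \<and> u \<noteq> v \<and> (v, u) \<in> A"
  shows "graph (with_proj \<lparr>pverts = V, parcs = A\<rparr>)"
proof -
  have "finite A"
    using assms(2) by (intro finite_subset[OF _ finite_cartesian_product[OF assms(1,1)]]) auto
  then have "pair_graph \<lparr>pverts = V, parcs = A\<rparr>"
    using assms by unfold_locales (auto simp: symmetric_def intro: symI dest: assms(2))
  then show ?thesis
    by (rule pair_graph.pair_graphD_graph)
qed

lemma adj_sym: "adj v u \<longleftrightarrow> adj u v"
proof (cases u; cases v)
  fix s i t j assume "u = (s, i)" "v = (t, j)"
  then show ?thesis
    using link_sym[of t s "j - i"] by simp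
qed

lemma graph_bicirculant: "graph bicirculant"
  unfolding bicirculant_def
  by (rule graph_with_proj) (auto simp: adj_sym link_not_self)

subsection \<open>Affine automorphisms\<close>

fun affine :: "int \<Rightarrow> nat \<Rightarrow> bool \<times> int \<Rightarrow> bool \<times> int" where
  "affine n k (s, i) = (s \<noteq> odd k, (7 ^ k * i + n) mod 25)"

lemma affine_affine: "affine n k (affine n' k' v) = affine (n + 7 ^ k * n') (k + k') v"
proof (cases v)
  case (Pair s i)
  have "(7 ^ k * ((7 ^ k' * i + n') mod 25) + n) mod 25 = (7 ^ k * (7 ^ k' * i + n') + n) mod 25"
    by (metis mod_add_left_eq mod_mult_right_eq)
  also have "7 ^ k * (7 ^ k' * i + n') + n = 7 ^ (k + k') * i + (n + 7 ^ k * n')"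
    by (simp add: algebra_simps power_add)
  finally show ?thesis
    by (auto simp: Pair)
qed

lemma power_7_mod_25: "(7::int) ^ k mod 25 = 7 ^ (k mod 4) mod 25"
proof -
  have "(7::int) ^ k = 7 ^ (4 * (k div 4) + k mod 4)"
    by simp
  also have "\<dots> = (7 ^ 4) ^ (k div 4) * 7 ^ (k mod 4)"
    by (simp only: power_add power_mult)
  also have "\<dots> mod 25 = ((7 ^ 4 mod 25) ^ (k div 4) * 7 ^ (k mod 4)) mod 25"
    by (metis mod_mult_left_eq power_mod)
  finally show ?thesis
    by simp
qed

lemma affine_cong:
  assumes "n mod 25 = n' mod 25" "k mod 4 = k' mod 4"
  shows "affine n k v = affine n' k' v"
proof (cases v)
  case (Pair s i)
  have "odd k = odd k'"
    using assms(2) by presburger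
  moreover have "(7::int) ^ k mod 25 = 7 ^ k' mod 25"
    using power_7_mod_25[of k] power_7_mod_25[of k'] assms(2) by simp
  then have "(7 ^ k * i + n) mod 25 = (7 ^ k' * i + n') mod 25"
    using assms(1) by (metis mod_add_cong mod_mult_cong)
  ultimately show ?thesis
    by (simp add: Pair)
qed

lemma affine_in_verts: "affine n k v \<in> verts bicirculant"
  by (cases v) (simp add: verts_bicirculant)

lemma affine_id: "v \<in> verts bicirculant \<Longrightarrow> affine 0 0 v = v"
  by (cases v) (simp add: verts_bicirculant)

text \<open>
  Since \<open>7\<^sup>4 = 1\<close> modulo 25, the power \<open>7\<^sup>3\<^sup>k\<close> is inverse to \<open>7\<^sup>k\<close>; the parities of \<open>3 k\<close> and \<open>k\<close> agree.
\<close>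

lemma affine_inverse:
  assumes v: "v \<in> verts bicirculant"
  shows "affine n k (affine (- (7 ^ (3 * k) * n)) (3 * k) v) = v"
    and "affine (- (7 ^ (3 * k) * n)) (3 * k) (affine n k v) = v"
proof -
  have "(7::int) ^ k * 7 ^ (3 * k) = 7 ^ (4 * k)"
    by (subst power_add[symmetric]) simp
  also have "\<dots> mod 25 = 1"
    by (subst power_7_mod_25) simp
  finally have "(7 ^ k * 7 ^ (3 * k)) * n mod 25 = 1 * n mod 25"
    by (intro mod_mult_cong) simp_all
  then have "(n + 7 ^ k * - (7 ^ (3 * k) * n)) mod 25 = 0 mod 25"
    by (simp add: mod_eq_dvd_iff mult.assoc dvd_diff_commute flip: dvd_eq_mod_eq_0)
  then have "affine (n + 7 ^ k * - (7 ^ (3 * k) * n)) (k + 3 * k) v = affine 0 0 v"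
    by (rule affine_cong) simp
  then show "affine n k (affine (- (7 ^ (3 * k) * n)) (3 * k) v) = v"
    by (simp only: affine_affine affine_id[OF v])
  have "affine (- (7 ^ (3 * k) * n) + 7 ^ (3 * k) * n) (3 * k + k) v = affine 0 0 v"
    by (rule affine_cong) simp_all
  then show "affine (- (7 ^ (3 * k) * n)) (3 * k) (affine n k v) = v"
    by (simp only: affine_affine affine_id[OF v])
qed

lemma affine_adj: "adj (affine n k u) (affine n k v) \<longleftrightarrow> adj u v"
proof (cases u; cases v)
  fix s i t j assume uv: "u = (s, i)" "v = (t, j)"
  have "((7 ^ k * j + n) mod 25 - (7 ^ k * i + n) mod 25) mod 25 = (7 ^ k * (j - i)) mod 25"
    by (simp add: mod_diff_eq right_diff_distrib)
  from link_cong[OF this] show ?thesis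
    by (simp only: uv affine.simps adj.simps link_times_7_power)
qed

lemma affine_graph_iso: "graph_iso (affine n k) bicirculant bicirculant"
proof -
  have "bij_betw (affine n k) (verts bicirculant) (verts bicirculant)"
    by (rule bij_betw_byWitness[where f' = "affine (- (7 ^ (3 * k) * n)) (3 * k)"])
      (auto simp: affine_inverse affine_in_verts simp del: affine.simps)
  then show ?thesis
    by (simp add: graph_iso_def bicirculant_adj affine_in_verts affine_adj del: affine.simps)
qed

lemma affine_transitive:
  assumes "u \<in> verts bicirculant"
  shows "affine (snd u) (of_bool (fst u)) (False, 0) = u"
  using assms by (cases u) (auto simp: verts_bicirculant)

subsection \<open>Strong regularity\<close>

definition vertex_list :: "(bool \<times> int) list" where
  "vertex_list = map (Pair False) [0..24] @ map (Pair True) [0..24]"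

definition origin_nbrs :: "(bool \<times> int) list" where
  "origin_nbrs = filter (adj (False, 0)) vertex_list"

lemma set_vertex_list: "set vertex_list = verts bicirculant"
  by (auto simp: vertex_list_def verts_bicirculant image_iff)

lemma origin_nbrs_eq:
  "origin_nbrs = map (Pair False) [2, 3, 5, 6, 7, 12, 13, 18, 19, 20, 22, 23] @
          map (Pair True) [0, 3, 4, 6, 8, 17, 19, 21, 22]"
  by (simp add: origin_nbrs_def vertex_list_def upto_rec1 link_table)

lemma distinct_origin_nbrs: "distinct origin_nbrs"
  by (simp add: origin_nbrs_def vertex_list_def distinct_map inj_on_def) auto

lemma common_neighbours_origin:
  assumes "v \<in> verts bicirculant"
  shows "common_neighbours bicirculant (False, 0) v = set (filter (adj v) origin_nbrs)"
  using assms unfolding common_neighbours_def bicirculant_adj origin_nbrs_def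
  by (auto simp: set_vertex_list verts_bicirculant)

lemma card_common_neighbours_origin:
  assumes "v \<in> verts bicirculant"
  shows "card (common_neighbours bicirculant (False, 0) v) = length (filter (adj v) origin_nbrs)"
  unfolding common_neighbours_origin[OF assms]
  by (intro distinct_card distinct_filter distinct_origin_nbrs)

text \<open>
  The case \<open>v = (False, 0)\<close> gives the degree: a vertex and itself have all their neighbours in common.
\<close>

lemma length_common_nbrs:
  "\<forall>v \<in> set vertex_list. length (filter (adj v) origin_nbrs) =
     (if v = (False, 0) then 21 else if v \<in> set origin_nbrs then 8 else 9)"
  by (simp add: vertex_list_def origin_nbrs_eq upto_rec1 link_table)

lemma strongly_regular_bicirculant: "strongly_regular bicirculant 50 21 8 9"
proof (rule strongly_regular_transitiveI[OF graph_bicirculant])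
  show "card (verts bicirculant) = 50"
    by (simp add: verts_bicirculant card_cartesian_product)
  show origin: "(False, 0) \<in> verts bicirculant"
    by (simp add: verts_bicirculant)
  show "\<exists>f. graph_iso f bicirculant bicirculant \<and> f (False, 0) = u"
    if "u \<in> verts bicirculant" for u
    using affine_graph_iso affine_transitive[OF that] by blast
  note count = card_common_neighbours_origin length_common_nbrs[unfolded set_vertex_list, rule_format]
  show "card (common_neighbours bicirculant (False, 0) (False, 0)) = 21"
    using origin by (simp add: count)
  have nbr: "(False, 0) \<rightarrow>\<^bsub>bicirculant\<^esub> v \<longleftrightarrow> v \<in> set origin_nbrs" if "v \<in> verts bicirculant" for v
    using that origin by (simp add: bicirculant_adj origin_nbrs_def set_vertex_list)
  show "card (common_neighbours bicirculant (False, 0) v) = 8"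
    if "v \<in> verts bicirculant" "(False, 0) \<rightarrow>\<^bsub>bicirculant\<^esub> v" for v
    using that nbr[OF that(1)] by (auto simp: count bicirculant_adj link_not_self)
  show "card (common_neighbours bicirculant (False, 0) v) = 9"
    if "v \<in> verts bicirculant" "(False, 0) \<noteq> v" "\<not> (False, 0) \<rightarrow>\<^bsub>bicirculant\<^esub> v" for v
    using that nbr[OF that(1)] by (auto simp: count)
qed

subsection \<open>The full automorphism group\<close>

text \<open>
  The isomorphism invariant that breaks the regularity of the graph. The 14 arcs are 7 edges; the
  other edges have 8, 9 or 10 edges among the common neighbours of their ends.
\<close>

definition sparse_edge :: "('a, 'b) pre_digraph \<Rightarrow> 'a \<Rightarrow> 'a \<Rightarrow> bool" where
  "sparse_edge G u v \<longleftrightarrow> u \<rightarrow>\<^bsub>G\<^esub> v \<and> arcs_among G (common_neighbours G u v) = 14"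

lemma sparse_edge_iso:
  assumes f: "graph_iso f G H" and uv: "u \<in> verts G" "v \<in> verts G"
  shows "sparse_edge H (f u) (f v) \<longleftrightarrow> sparse_edge G u v"
proof -
  have "common_neighbours G u v \<subseteq> verts G"
    by (auto simp: common_neighbours_def)
  then show ?thesis
    by (simp add: sparse_edge_def graph_iso_adj[OF assms] common_neighbours_iso[OF assms]
        arcs_among_iso[OF f])
qed

lemma arcs_among_list:
  assumes "distinct ws" "set ws \<subseteq> verts bicirculant"
  shows "arcs_among bicirculant (set ws) =
    length (filter (\<lambda>(w, z). adj w z) (List.product ws ws))"
proof -
  have "{(w, z) \<in> set ws \<times> set ws. w \<rightarrow>\<^bsub>bicirculant\<^esub> z} =
      set (filter (\<lambda>(w, z). adj w z) (List.product ws ws))"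
    using assms(2) by (auto simp: bicirculant_adj)
  then show ?thesis
    unfolding arcs_among_def using assms(1) by (simp only: distinct_card distinct_filter distinct_product)
qed

lemma arcs_among_common_nbrs:
  assumes "v \<in> set origin_nbrs"
  shows "length (filter (\<lambda>(w, z). adj w z)
      (List.product (filter (adj v) origin_nbrs) (filter (adj v) origin_nbrs))) = 14 \<longleftrightarrow>
    v = (False, 2) \<or> v = (False, 23)"
  using assms unfolding origin_nbrs_eq list.map append.simps list.set insert_iff empty_iff
  by (elim disjE FalseE; hypsubst; simp add: link_table)

lemma sparse_edge_origin:
  assumes v: "v \<in> verts bicirculant"
  shows "sparse_edge bicirculant (False, 0) v \<longleftrightarrow> v = (False, 2) \<or> v = (False, 23)"
proof -
  have origin: "(False, 0) \<in> verts bicirculant"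
    by (simp add: verts_bicirculant)
  have nbr: "(False, 0) \<rightarrow>\<^bsub>bicirculant\<^esub> v \<longleftrightarrow> v \<in> set origin_nbrs"
    using v origin by (simp add: bicirculant_adj origin_nbrs_def set_vertex_list)
  have "set (filter (adj v) origin_nbrs) \<subseteq> verts bicirculant"
    by (auto simp: origin_nbrs_def set_vertex_list)
  then have "sparse_edge bicirculant (False, 0) v \<longleftrightarrow> v \<in> set origin_nbrs \<and>
      length (filter (\<lambda>(w, z). adj w z)
        (List.product (filter (adj v) origin_nbrs) (filter (adj v) origin_nbrs))) = 14"
    unfolding sparse_edge_def nbr common_neighbours_origin[OF v]
    by (subst arcs_among_list) (auto intro: distinct_origin_nbrs distinct_filter)
  moreover have "(False, 2) \<in> set origin_nbrs" "(False, 23) \<in> set origin_nbrs"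
    by (simp_all add: origin_nbrs_eq)
  ultimately show ?thesis
    using arcs_among_common_nbrs by blast
qed

text \<open>
  By translation, every vertex of the first coset has exactly two sparse edges, so that these edges
  form a cycle with steps of length 2.
\<close>

lemma sparse_edge_translate:
  assumes v: "v \<in> verts bicirculant" and uv: "sparse_edge bicirculant (False, i mod 25) v"
  shows "v = (False, (i + 2) mod 25) \<or> v = (False, (i - 2) mod 25)"
proof -
  define w where "w = affine (- i) 0 v"
  have w: "w \<in> verts bicirculant"
    by (simp add: w_def affine_in_verts)
  have v_eq: "v = affine i 0 w"
    using affine_inverse(1)[OF v, of i 0] by (simp add: w_def del: affine.simps)
  have "affine i 0 (False, 0) = (False, i mod 25)"
    by simp
  then have "sparse_edge bicirculant (affine i 0 (False, 0)) (affine i 0 w)"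
    using uv by (simp only: v_eq)
  then have "sparse_edge bicirculant (False, 0) w"
    using sparse_edge_iso[OF affine_graph_iso _ w] by (simp add: verts_bicirculant del: affine.simps)
  then have "w = (False, 2) \<or> w = (False, 23)"
    using sparse_edge_origin[OF w] by simp
  moreover have "(23 + i) mod 25 = (i - 2) mod 25"
    by (simp add: mod_eq_dvd_iff)
  ultimately show ?thesis
    by (auto simp: v_eq add.commute[of _ i])
qed

lemma sparse_edge_step: "sparse_edge bicirculant (False, i mod 25) (False, (i + 2) mod 25)"
proof -
  have "sparse_edge bicirculant (affine i 0 (False, 0)) (affine i 0 (False, 2))"
    by (subst sparse_edge_iso[OF affine_graph_iso])
      (simp_all add: verts_bicirculant sparse_edge_origin)
  then show ?thesis
    by (simp add: add.commute)
qed

text \<open>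
  The connection set between the cosets has no period, hence a vertex of the second coset is
  determined by its neighbours in the first one.
\<close>

lemma link_shift:
  assumes "\<And>x. link False True x \<longleftrightarrow> link False True (x - d)"
  shows "d mod 25 = 0"
proof -
  have "\<forall>d \<in> set [0..24]. (\<forall>x \<in> set [0..24]. link False True x \<longleftrightarrow> link False True (x - d)) \<longrightarrow> d = 0"
    by (simp add: upto_rec1 link_table)
  moreover have "link False True x \<longleftrightarrow> link False True (x - d mod 25)" for x
    using assms[of x] link_cong[of "x - d" "x - d mod 25"] by (simp add: mod_diff_right_eq)
  ultimately show ?thesis
    using mod_25_in_upto by blast
qed

text \<open>
  The fixed sparse edge is the start of the cycle: each further vertex of the cycle is the only sparse
  neighbour of its predecessor that is not already the image of a fixed vertex. As 2 is prime to 25,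
  the cycle runs through the whole first coset.
\<close>

lemma bicirculant_rigid:
  assumes f: "graph_iso f bicirculant bicirculant"
    and f0: "f (False, 0) = (False, 0)" and f2: "f (False, 2) = (False, 2)"
    and v: "v \<in> verts bicirculant"
  shows "f v = v"
proof -
  have vert: "(s, i mod 25) \<in> verts bicirculant" for s i
    by (simp add: verts_bicirculant)
  have even: "f (False, 2 * int n mod 25) = (False, 2 * int n mod 25) \<and>
      f (False, (2 * int n + 2) mod 25) = (False, (2 * int n + 2) mod 25)" for n
  proof (induction n)
    case 0
    show ?case by (simp add: f0 f2)
  next
    case (Suc n)
    define i where "i = 2 * int n + 2"
    have IH: "f (False, (i - 2) mod 25) = (False, (i - 2) mod 25)"
        "f (False, i mod 25) = (False, i mod 25)"
      using Suc by (simp_all add: i_def)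
    have "sparse_edge bicirculant (False, i mod 25) (f (False, (i + 2) mod 25))"
      using sparse_edge_iso[OF f vert vert] sparse_edge_step[of i] IH(2) by metis
    then have "f (False, (i + 2) mod 25) = (False, (i + 2) mod 25) \<or>
        f (False, (i + 2) mod 25) = f (False, (i - 2) mod 25)"
      using sparse_edge_translate graph_iso_in_verts[OF f vert] IH(1) by metis
    moreover have "(i + 2) mod 25 \<noteq> (i - 2) mod 25"
      by (simp add: mod_eq_dvd_iff)
    ultimately have "f (False, (i + 2) mod 25) = (False, (i + 2) mod 25)"
      using graph_iso_eq_iff[OF f vert vert] by blast
    with IH(2) show ?case
      by (simp add: i_def algebra_simps)
  qed
  have X: "f (False, i) = (False, i)" if "i \<in> {0..<25}" for i
  proof -
    \<comment> \<open>13 is the inverse of 2 modulo 25, so \<open>i\<close> is reached after \<open>13 i\<close> steps.\<close>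
    have "2 * int (nat (13 * i)) = i + i * 25"
      using that by simp
    then have "2 * int (nat (13 * i)) mod 25 = i"
      using that by (simp only: mod_mult_self1) simp
    with even[of "nat (13 * i)"] show ?thesis
      by (simp only:)
  qed
  show ?thesis
  proof (cases v)
    case (Pair s j)
    have j: "j \<in> {0..<25}"
      using v by (simp add: Pair verts_bicirculant)
    show ?thesis
    proof (cases s)
      case False
      then show ?thesis
        using X[OF j] by (simp add: Pair)
    next
      case True
      obtain t l where tl: "f v = (t, l)"
        by (cases "f v")
      then have l: "l \<in> {0..<25}"
        using graph_iso_in_verts[OF f v] by (simp add: verts_bicirculant)
      have t
      proof (rule ccontr)
        assume "\<not> t"
        then have "f v = f (False, l)"
          using tl X[OF l] by simp
        then show False
          using graph_iso_eq_iff[OF f v, of "(False, l)"] l True by (simp add: Pair verts_bicirculant)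
      qed
      have "link False True x \<longleftrightarrow> link False True (x - (j - l))" for x
      proof -
        define i where "i = (j - x) mod 25"
        have i: "i \<in> {0..<25}" "(False, i) \<in> verts bicirculant"
          by (simp_all add: i_def verts_bicirculant)
        have "adj (False, i) (True, l) \<longleftrightarrow> adj (False, i) (True, j)"
          using graph_iso_adj[OF f i(2) v] graph_iso_in_verts[OF f v] v i X[OF i(1)]
          unfolding tl by (simp add: bicirculant_adj Pair True \<open>t\<close>)
        moreover have "(l - i) mod 25 = (x - (j - l)) mod 25" "(j - i) mod 25 = x mod 25"
          by (simp_all add: i_def mod_diff_right_eq algebra_simps)
        ultimately show ?thesis
          by (simp add: link_def)
      qed
      then have "(j - l) mod 25 = 0"
        by (rule link_shift)
      then have "j mod 25 = l mod 25"
        by (simp add: mod_eq_dvd_iff mod_eq_0_iff_dvd)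
      then have "j = l"
        using j l by simp
      then show ?thesis
        using tl True \<open>t\<close> by (simp add: Pair)
    qed
  qed
qed

text \<open>
  After composition with an affine map the automorphism fixes \<open>(False, 0)\<close>, and it can only
  fix \<open>(False, 2)\<close> or send it to the other sparse neighbour \<open>(False, 23)\<close>. In the second case the
  map \<open>i \<mapsto> 7\<^sup>2 i = - i\<close> leads back to the first.
\<close>

lemma bicirculant_automorphism_is_affine:
  assumes f: "graph_iso f bicirculant bicirculant"
  obtains n k where "\<And>v. v \<in> verts bicirculant \<Longrightarrow> f v = affine n k v"
proof -
  have origin: "(False, 0) \<in> verts bicirculant" and two: "(False, 2) \<in> verts bicirculant"
    by (simp_all add: verts_bicirculant)
  obtain n k where nk: "f (False, 0) = affine n k (False, 0)"
    using affine_transitive[OF graph_iso_in_verts[OF f origin]] by metis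
  define g where "g = affine (- (7 ^ (3 * k) * n)) (3 * k) \<circ> f"
  have g: "graph_iso g bicirculant bicirculant"
    unfolding g_def by (rule graph_iso_comp[OF f affine_graph_iso])
  have g0: "g (False, 0) = (False, 0)"
    by (simp only: g_def o_apply nk affine_inverse[OF origin])
  have f_eq: "f v = affine n k (g v)" if "v \<in> verts bicirculant" for v
    using affine_inverse(1)[OF graph_iso_in_verts[OF f that]] by (simp only: g_def o_apply)
  have "sparse_edge bicirculant (False, 0) (False, 2)"
    by (simp add: sparse_edge_origin two)
  then have "sparse_edge bicirculant (False, 0) (g (False, 2))"
    using sparse_edge_iso[OF g origin two] g0 by simp
  then consider "g (False, 2) = (False, 2)" | "g (False, 2) = (False, 23)"
    using sparse_edge_origin[OF graph_iso_in_verts[OF g two]] by blast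
  then show thesis
  proof cases
    case 1
    then have "f v = affine n k v" if "v \<in> verts bicirculant" for v
      using bicirculant_rigid[OF g g0 _ that] f_eq[OF that] by simp
    then show thesis
      by (rule that)
  next
    case 2
    have "graph_iso (affine 0 2 \<circ> g) bicirculant bicirculant"
      by (rule graph_iso_comp[OF g affine_graph_iso])
    moreover have "(affine 0 2 \<circ> g) (False, 0) = (False, 0)" "(affine 0 2 \<circ> g) (False, 2) = (False, 2)"
      using 2 g0 by simp_all
    ultimately have "affine 0 2 (g v) = v" if "v \<in> verts bicirculant" for v
      using bicirculant_rigid[OF _ _ _ that] by (metis o_apply)
    \<comment> \<open>The exponent 6 is what \<open>affine_inverse\<close> gives for the exponent 2.\<close>
    then have "g v = affine 0 6 v" if "v \<in> verts bicirculant" for v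
      using affine_inverse(2)[OF graph_iso_in_verts[OF g that], of 2 0] that by simp
    then have "f v = affine n (k + 6) v" if "v \<in> verts bicirculant" for v
      using f_eq[OF that] that by (simp add: affine_affine)
    then show thesis
      by (rule that)
  qed
qed

definition mult_by_7_power :: "int \<Rightarrow> int \<Rightarrow> int" where
  "mult_by_7_power k = (\<lambda>n \<in> carrier (integer_mod_group 25). 7 ^ nat k * n mod 25)"

lemma mult_by_7_power_hom:
  "mult_by_7_power \<in> hom (integer_mod_group 4) (AutoGroup (integer_mod_group 25))"
proof -
  let ?C = "carrier (integer_mod_group 25)"
  have C: "?C = {0..<25}"
    by (simp add: carrier_integer_mod_group)
  have comp: "7 ^ a * (7 ^ b * n mod 25) mod 25 = 7 ^ (a + b) * n mod 25" for a b and n :: int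
    by (simp add: mod_mult_right_eq power_add mult.assoc)
  have period: "7 ^ a * n mod 25 = 7 ^ (a mod 4) * n mod 25" for a and n :: int
    by (intro mod_mult_cong power_7_mod_25 refl)
  have bij: "mult_by_7_power k \<in> Bij ?C" for k
  proof -
    have inverse: "7 ^ (3 * nat k) * (7 ^ nat k * n mod 25) mod 25 = n"
      "7 ^ nat k * (7 ^ (3 * nat k) * n mod 25) mod 25 = n" if "n \<in> {0..<25}" for n :: int
      using that period[of "4 * nat k" n] by (simp_all add: comp)
    have "bij_betw (mult_by_7_power k) ?C ?C"
      by (rule bij_betw_byWitness[where f' = "\<lambda>n. 7 ^ (3 * nat k) * n mod 25"])
        (auto simp: mult_by_7_power_def C inverse)
    then show ?thesis
      by (simp add: Bij_def mult_by_7_power_def)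
  qed
  have auto: "mult_by_7_power k \<in> auto (integer_mod_group 25)" for k
    using bij[of k]
    by (auto simp: auto_def hom_def mult_by_7_power_def C mod_simps distrib_left)
  have "mult_by_7_power ((k + k') mod 4) = compose ?C (mult_by_7_power k) (mult_by_7_power k')"
    if "k \<in> {0..<4}" "k' \<in> {0..<4}" for k k'
  proof -
    have "nat ((k + k') mod 4) = (nat k + nat k') mod 4"
      using that by (simp add: nat_mod_distrib nat_add_distrib)
    then show ?thesis
      by (auto simp: fun_eq_iff compose_def mult_by_7_power_def C comp simp flip: period)
  qed
  then show ?thesis
    using auto bij
    by (intro homI) (auto simp: AutoGroup_def BijGroup_def carrier_integer_mod_group)
qed

text \<open>
  The composition rule of affine maps is the multiplication of the semidirect product. A
  pair \<open>(n, k)\<close> can be recovered from the images of the exponents 0 and 1, which are \<open>n\<close> and \<open>7\<^sup>k + n\<close>,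
  as the four powers of 7 are distinct modulo 25.
\<close>

lemma AutoGroup_bicirculant:
  "semidirect_product (integer_mod_group 25) (integer_mod_group 4) mult_by_7_power
    \<cong> graph_AutoGroup bicirculant"
proof -
  let ?S = "semidirect_product (integer_mod_group 25) (integer_mod_group 4) mult_by_7_power"
  have S: "carrier ?S = {0..<25} \<times> {0..<4}"
    by (simp add: semidirect_product_def carrier_integer_mod_group)
  define \<Phi> where "\<Phi> = (\<lambda>(n, k). restrict (affine n (nat k)) (verts bicirculant))"
  have \<Phi>_auto: "\<Phi> x \<in> graph_autos bicirculant" for x
    using graph_iso_cong[OF affine_graph_iso] by (auto simp: \<Phi>_def graph_autos_iff split: prod.split)
  have hom: "\<Phi> (x \<otimes>\<^bsub>?S\<^esub> y) = compose (verts bicirculant) (\<Phi> x) (\<Phi> y)"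
    if xy: "x \<in> carrier ?S" "y \<in> carrier ?S" for x y
  proof -
    obtain n k n' k' where eq: "x = (n, k)" "y = (n', k')"
      by (cases x, cases y)
    have in_range: "n' \<in> {0..<25}" "k \<in> {0..<4}" "k' \<in> {0..<4}"
      using xy by (auto simp: eq S)
    have "nat ((k + k') mod 4) = (nat k + nat k') mod 4"
      using in_range by (simp add: nat_mod_distrib nat_add_distrib)
    then have "affine ((n + 7 ^ nat k * n' mod 25) mod 25) (nat ((k + k') mod 4)) v =
        affine n (nat k) (affine n' (nat k') v)" for v
      unfolding affine_affine by (intro affine_cong) (simp_all add: mod_simps)
    then show ?thesis
      using in_range
      by (auto simp: eq \<Phi>_def semidirect_product_def compose_def fun_eq_iff affine_in_verts
          mult_by_7_power_def carrier_integer_mod_group simp del: affine.simps)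
  qed
  have inj: "inj_on \<Phi> (carrier ?S)"
  proof (rule inj_onI)
    fix x y assume xy: "x \<in> carrier ?S" "y \<in> carrier ?S" and eq: "\<Phi> x = \<Phi> y"
    obtain n k n' k' where x: "x = (n, k)" and y: "y = (n', k')"
      by (cases x, cases y)
    have in_range: "n \<in> {0..<25}" "n' \<in> {0..<25}" "k \<in> {0, 1, 2, 3}" "k' \<in> {0, 1, 2, 3}"
      using xy by (auto simp: x y S)
    have "affine n (nat k) v = affine n' (nat k') v" if "v \<in> {(False, 0), (False, 1)}" for v
      using fun_cong[OF eq, of v] that
      by (auto simp: x y \<Phi>_def verts_bicirculant simp del: affine.simps)
    then have 0: "affine n (nat k) (False, 0) = affine n' (nat k') (False, 0)"
      and 1: "affine n (nat k) (False, 1) = affine n' (nat k') (False, 1)"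
      by blast+
    from 0 have n: "n = n'"
      using in_range by simp
    have "7 ^ nat k mod 25 = (7 ^ nat k' mod 25 :: int)"
      using 1 by (simp add: n mod_eq_dvd_iff)
    then have "k = k'"
      using in_range(3,4) by (elim insertE emptyE) simp_all
    with n show "x = y"
      by (simp add: x y)
  qed
  have surj: "f \<in> \<Phi> ` carrier ?S" if f: "f \<in> graph_autos bicirculant" for f
  proof -
    obtain n k where nk: "\<And>v. v \<in> verts bicirculant \<Longrightarrow> f v = affine n k v"
      using bicirculant_automorphism_is_affine f unfolding graph_autos_iff by blast
    have "f = \<Phi> (n mod 25, int (k mod 4))"
    proof (rule extensionalityI[of _ "verts bicirculant"])
      show "f \<in> extensional (verts bicirculant)"
        using f by (simp add: graph_autos_iff)
      show "\<Phi> (n mod 25, int (k mod 4)) \<in> extensional (verts bicirculant)"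
        by (simp add: \<Phi>_def)
      show "f v = \<Phi> (n mod 25, int (k mod 4)) v" if "v \<in> verts bicirculant" for v
        using that nk[OF that] affine_cong[of n "n mod 25" k "k mod 4" v]
        by (simp add: \<Phi>_def nat_mod_distrib del: affine.simps)
    qed
    moreover have "(n mod 25, int (k mod 4)) \<in> carrier ?S"
      by (simp add: S)
    ultimately show ?thesis
      by (rule image_eqI)
  qed
  have "bij_betw \<Phi> (carrier ?S) (graph_autos bicirculant)"
    using \<Phi>_auto inj surj by (auto simp: bij_betw_def)
  then have "\<Phi> \<in> iso ?S (graph_AutoGroup bicirculant)"
    using hom \<Phi>_auto
    by (intro isoI homI) (auto simp: graph_AutoGroup_def BijGroup_def graph_autos_def)
  then show ?thesis
    by (auto simp: is_iso_def)
qed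

section \<open>Arithmetic modulo 1117901\<close>

subsection \<open>Primality and a primitive root\<close>

lemma prime_divisor_in_list:
  fixes q :: nat
  assumes "prime q" "q dvd prod_list rs" "\<forall>r \<in> set rs. prime r"
  shows "q \<in> set rs"
  using assms by (induction rs) (auto simp: prime_dvd_mult_iff primes_dvd_imp_eq)

text \<open>
  Lucas' primality test with the factorisation of \<open>n - 1\<close> given as a list. The conditions that make
  \<open>n\<close> prime also say that \<open>a\<close> is a primitive root, which is why they are kept as a second conclusion.
\<close>

lemma lucas_list:
  fixes a n :: nat
  assumes n: "n \<ge> 2" "n - 1 = prod_list qs" and a: "mod_exp a (n - 1) n = 1"
    and qs: "\<forall>q \<in> set qs. prime q" "\<forall>q \<in> set qs. mod_exp a ((n - 1) div q) n \<noteq> 1"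
  shows "prime n"
    and "\<And>q. prime q \<Longrightarrow> q dvd n - 1 \<Longrightarrow> [a ^ ((n - 1) div q) \<noteq> 1] (mod n)"
proof -
  show nontriv: "[a ^ ((n - 1) div q) \<noteq> 1] (mod n)" if "prime q" "q dvd n - 1" for q
    using that n qs prime_divisor_in_list[of q qs] by (auto simp: cong_power_nat_code)
  have "[a ^ (n - 1) = 1] (mod n)"
    using n(1) a by (simp only: cong_power_nat_code) simp
  with n(1) nontriv show "prime n"
    by (intro lucas[of n a]) auto
qed

text \<open>
  If the order of \<open>a\<close> were a proper divisor of \<open>p - 1\<close>, it would divide \<open>(p - 1) div q\<close> for some prime
  \<open>q\<close>.
\<close>

lemma generate_primitive_root:
  fixes p a :: nat
  assumes p: "prime p" and a: "0 < a" "a < p"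
    and nontriv: "\<And>q. prime q \<Longrightarrow> q dvd p - 1 \<Longrightarrow> [a ^ ((p - 1) div q) \<noteq> 1] (mod p)"
  shows "generate (mult_of (residue_ring (int p))) {int a} =
    carrier (mult_of (residue_ring (int p)))"
proof -
  define R where "R = residue_ring (int p)"
  interpret residues_prime p R
    by unfold_locales (simp_all add: R_def p)
  let ?M = "mult_of R"
  interpret M: group ?M
    by (rule field_mult_group)
  have carrier: "carrier ?M = {1..int p - 1}"
    using prime_gt_1_nat[OF p] by (auto simp: res_carrier_eq res_zero_eq)
  have order: "order ?M = p - 1"
    unfolding order_def carrier by simp
  have a_in: "int a \<in> carrier ?M"
    unfolding carrier using a by simp
  have pow: "int a [^]\<^bsub>?M\<^esub> m = int (a ^ m mod p)" for m
    using pow_cong[of "int a" m] a by (simp add: nat_pow_mult_of zmod_int)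
  have "M.ord (int a) = p - 1"
  proof (rule ccontr)
    assume ne: "M.ord (int a) \<noteq> p - 1"
    have dvd: "M.ord (int a) dvd p - 1"
      using M.ord_dvd_group_order[OF a_in] by (simp add: order)
    then obtain k where k: "p - 1 = M.ord (int a) * k"
      by blast
    with ne have "k \<noteq> 1"
      by auto
    then obtain q where q: "prime q" "q dvd k"
      using prime_factor_nat by blast
    then have "M.ord (int a) dvd (p - 1) div q"
      using k by (auto simp: dvd_def)
    then have "int a [^]\<^bsub>?M\<^esub> ((p - 1) div q) = \<one>\<^bsub>?M\<^esub>"
      using M.pow_eq_id[OF a_in] by blast
    then have "a ^ ((p - 1) div q) mod p = 1"
      by (simp add: pow res_one_eq)
    then have "[a ^ ((p - 1) div q) = 1] (mod p)"
      using prime_gt_1_nat[OF p] by (simp add: cong_def)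
    moreover have "q dvd p - 1"
      using q(2) k by simp
    ultimately show False
      using nontriv[OF q(1)] by blast
  qed
  then have "card (generate ?M {int a}) = card (carrier ?M)"
    using M.generate_pow_card[OF a_in] order unfolding order_def by simp
  moreover have "generate ?M {int a} \<subseteq> carrier ?M"
    by (rule M.generate_incl) (use a_in in blast)
  moreover have "finite (carrier ?M)"
    unfolding carrier by simp
  ultimately show ?thesis
    unfolding R_def[symmetric] by (intro card_subset_eq)
qed

lemma prime_1597: "prime (1597::nat)"
  by (rule lucas_list(1)[of _ "[2, 2, 3, 7, 19]" 11]) simp_all

lemma prime_1117901: "prime (1117901::nat)"
  and primitive_root_2: "\<And>q. prime q \<Longrightarrow> q dvd 1117901 - 1 \<Longrightarrow>
    [2 ^ ((1117901 - 1) div q) \<noteq> 1] (mod (1117901::nat))"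
proof -
  have n: "2 \<le> (1117901::nat)" "1117901 - 1 = prod_list [2, 2, 5, 5, 7, 1597::nat]"
    and 1: "mod_exp (2::nat) (1117901 - 1) 1117901 = 1"
    and nontriv: "\<forall>q \<in> set [2, 2, 5, 5, 7, 1597::nat]. mod_exp (2::nat) ((1117901 - 1) div q) 1117901 \<noteq> 1"
    by simp_all
  have "prime (2::nat)" "prime (5::nat)" "prime (7::nat)"
    by simp_all
  then have primes: "\<forall>q \<in> set [2, 2, 5, 5, 7, 1597::nat]. prime q"
    using prime_1597 by (simp only: list.set ball_simps simp_thms)
  show "prime (1117901::nat)"
    by (rule lucas_list(1)[OF n 1 primes nontriv])
  show "[2 ^ ((1117901 - 1) div q) \<noteq> 1] (mod (1117901::nat))"
    if "prime q" "q dvd 1117901 - 1" for q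
    by (rule lucas_list(2)[OF n 1 primes nontriv that])
qed

subsection \<open>The Legendre symbol\<close>

lemma Legendre_values: "Legendre a p = 0 \<or> Legendre a p = 1 \<or> Legendre a p = - 1"
  by (simp add: Legendre_def)

lemma QuadRes_cong: "[a = b] (mod p) \<Longrightarrow> QuadRes p a \<longleftrightarrow> QuadRes p b"
  unfolding QuadRes_def by (meson cong_sym cong_trans)

lemma Legendre_cong:
  assumes "[a = b] (mod p)"
  shows "Legendre a p = Legendre b p"
  using assms QuadRes_cong[OF assms] unfolding Legendre_def by (auto simp: cong_def)

lemma Legendre_eqI:
  assumes "p > 2" "[Legendre a p = x] (mod p)" "x \<in> {- 1, 0, 1}"
  shows "Legendre a p = x"
proof -
  have "\<bar>Legendre a p - x\<bar> < p"
    using Legendre_values[of a p] assms(1,3) by auto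
  moreover have "p dvd Legendre a p - x"
    using assms(2) by (simp add: cong_iff_dvd_diff)
  ultimately show ?thesis
    using zdvd_imp_le[of p "\<bar>Legendre a p - x\<bar>"] by force
qed

text \<open>
  Immediate from Euler's criterion, since distinct values of the symbol are incongruent modulo
  \<open>p > 2\<close>.
\<close>

lemma Legendre_mult:
  assumes p: "prime (p::nat)" "p > 2"
  shows "Legendre (a * b) (int p) = Legendre a (int p) * Legendre b (int p)"
proof (rule Legendre_eqI)
  have "[Legendre (a * b) (int p) = (a * b) ^ ((p - 1) div 2)] (mod int p)"
    by (rule euler_criterion[OF p])
  also have "(a * b) ^ ((p - 1) div 2) = a ^ ((p - 1) div 2) * b ^ ((p - 1) div 2)"
    by (rule power_mult_distrib)
  also have "[\<dots> = Legendre a (int p) * Legendre b (int p)] (mod int p)"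
    by (intro cong_mult cong_sym[OF euler_criterion[OF p]])
  finally show "[Legendre (a * b) (int p) = Legendre a (int p) * Legendre b (int p)] (mod int p)" .
  show "Legendre a (int p) * Legendre b (int p) \<in> {- 1, 0, 1}"
    using Legendre_values[of a "int p"] Legendre_values[of b "int p"] by auto
qed (use p in simp)

lemma Legendre_square: "\<not> [r = 0] (mod p) \<Longrightarrow> prime p \<Longrightarrow> Legendre (r ^ 2) p = 1"
  by (auto simp: Legendre_def QuadRes_def cong_0_iff prime_dvd_power_iff intro!: exI[of _ r])

lemma nonzero_squares_residue_ring:
  assumes "p > 1"
  shows "nonzero_squares (residue_ring p) = {a \<in> {0..<p}. Legendre a p = 1}"
proof -
  have "(\<exists>y. a = y * y mod p \<and> 0 \<le> y \<and> y \<le> p - 1) \<longleftrightarrow> QuadRes p a" if "0 \<le> a" "a < p" for a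
  proof
    assume "QuadRes p a"
    then obtain y where "[y ^ 2 = a] (mod p)"
      by (auto simp: QuadRes_def)
    then have "a = (y mod p) * (y mod p) mod p"
      using that by (simp add: cong_def power2_eq_square mod_mult_eq)
    moreover have "0 \<le> y mod p" "y mod p \<le> p - 1"
      using assms pos_mod_bound[of p y] by auto
    ultimately show "\<exists>y. a = y * y mod p \<and> 0 \<le> y \<and> y \<le> p - 1"
      by blast
  qed (use that in \<open>auto simp: QuadRes_def cong_def power2_eq_square intro: mod_pos_pos_trivial\<close>)
  moreover have "Legendre a p = 1 \<longleftrightarrow> a \<noteq> 0 \<and> QuadRes p a" if "0 \<le> a" "a < p" for a
    using that by (simp add: Legendre_def cong_def)
  moreover have "0 \<le> y * y mod p" "y * y mod p < p" for y
    using assms by simp_all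
  ultimately show ?thesis
    unfolding nonzero_squares_def residue_ring_def by auto
qed

abbreviation legendre :: "int \<Rightarrow> int" where
  "legendre a \<equiv> Legendre a 1117901"

lemma prime_int_1117901: "prime (1117901::int)"
  using prime_1117901 by (metis of_nat_numeral prime_nat_int_transfer)

lemma legendre_mult: "legendre (a * b) = legendre a * legendre b"
  using Legendre_mult[OF prime_1117901, of a b] by simp

lemma legendre_2: "legendre 2 = - 1"
proof -
  have "(2::nat) < 1117901" "(1117901 - 1) div 2 = (558950::nat)"
    by simp_all
  then have "[legendre 2 = 2 ^ 558950] (mod 1117901)"
    using euler_criterion[OF prime_1117901, of 2] by (simp only: of_nat_numeral)
  also have "[(2::int) ^ 558950 = - 1] (mod 1117901)"
    unfolding cong_power_int_code by simp
  finally show ?thesis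
    by (intro Legendre_eqI) simp_all
qed

lemma legendre_minus: "legendre (- a) = legendre a"
proof -
  have "[legendre (- 1) = (- 1) ^ 558950] (mod 1117901)"
    using euler_criterion[OF prime_1117901, of "- 1"] by simp
  then have "legendre (- 1) = 1"
    by (intro Legendre_eqI) simp_all
  then show ?thesis
    using legendre_mult[of "- 1" a] by simp
qed

lemma legendre_1: "legendre 1 = 1"
  using Legendre_square[OF _ prime_int_1117901, of 1] by (simp add: cong_def)

text \<open>
  A certificate that is cheap to check: a square root of \<open>a\<close> shows that \<open>a\<close> is a square, and, 2 being
  a non-residue, a square root of \<open>2 a\<close> shows that it is not.
\<close>

lemma legendre_witness:
  assumes "r ^ 2 mod 1117901 = (if P then 1 else 2) * a mod 1117901" "0 < r" "r < 1117901"
  shows "legendre a = (if P then 1 else - 1)"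
proof -
  have "legendre ((if P then 1 else 2) * a) = legendre (r ^ 2)"
    using assms(1) by (intro Legendre_cong) (simp add: cong_def)
  also have "\<dots> = 1"
    using assms(2,3) by (intro Legendre_square prime_int_1117901) (simp add: cong_def)
  finally show ?thesis
    using Legendre_values[of a 1117901]
    by (auto simp: legendre_mult legendre_1 legendre_2 split: if_splits)
qed

subsection \<open>The vertices\<close>

text \<open>
  The powers of \<open>h = 424077\<close>.
\<close>

definition powers :: "int list" where
  "powers =
  [1, 424077, 96455, 349445, 394903, 1002325, 128092, 943593, 72008, 352900, 12727, 1951,
   127487, 376337, 965486, 221964, 327226, 615569, 884897, 749983, 998785, 236555, 452698,
   553115, 890431]"

lemma powers_nth: "n < 25 \<Longrightarrow> powers ! n = 424077 ^ n mod 1117901"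
proof (induction n)
  case (Suc n)
  have len: "length powers = 25"
    by (simp add: powers_def)
  have "map (\<lambda>x. x * 424077 mod 1117901) (butlast powers) = tl powers"
    by (simp add: powers_def)
  then have "powers ! Suc n = map (\<lambda>x. x * 424077 mod 1117901) (butlast powers) ! n"
    using Suc.prems len by (simp add: nth_tl)
  also have "\<dots> = powers ! n * 424077 mod 1117901"
    using Suc.prems len by (simp add: nth_butlast)
  also have "\<dots> = 424077 ^ Suc n mod 1117901"
    using Suc by (simp only: Suc_lessD mod_mult_left_eq power_Suc2)
  finally show ?case .
qed (simp add: powers_def)

lemma h_power_25: "(424077::int) ^ 25 mod 1117901 = 1"
proof -
  have "424077 ^ 25 mod 1117901 = powers ! 24 * 424077 mod 1117901"
    by (subst powers_nth) (simp_all only: mod_mult_left_eq flip: power_Suc2, simp)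
  then show ?thesis
    by (simp add: powers_def)
qed

text \<open>
  Square roots of \<open>1 - h\<^sup>d\<close>, or of twice that value if it is a non-residue. The entry at \<open>d = 0\<close> is a
  dummy.
\<close>

definition inner_roots :: "int list" where
  "inner_roots =
  [0, 525877, 396561, 66364, 504640, 373851, 521988, 423440, 192543, 242106, 17723, 404550,
   332274, 34418, 350027, 314493, 109028, 271619, 94682, 547055, 114405, 11989, 538021,
   164198, 215894]"

text \<open>
  The same for \<open>1 - g h\<^sup>d\<close>, where \<open>g = c h\<^sup>5 = 243806\<close>.
\<close>

definition cross_roots :: "int list" where
  "cross_roots =
  [538557, 22918, 179103, 217041, 267496, 359694, 281560, 167421, 205680, 539299, 36114,
   355040, 533679, 59748, 134570, 140497, 75350, 118319, 14300, 285317, 201274, 397271,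
   315944, 127726, 556752]"

lemma inner_table:
  "\<forall>d \<in> set [1..24]. (inner_roots ! nat d) ^ 2 mod 1117901 =
     (if link False False d then 1 else 2) * (1 - powers ! nat d) mod 1117901 \<and>
     0 < inner_roots ! nat d \<and> inner_roots ! nat d < 1117901"
  by (simp add: upto_rec1 link_table inner_roots_def powers_def)

lemma cross_table:
  "\<forall>d \<in> set [0..24]. (cross_roots ! nat d) ^ 2 mod 1117901 =
     (if link False True d then 1 else 2) * (1 - 243806 * powers ! nat d) mod 1117901 \<and>
     0 < cross_roots ! nat d \<and> cross_roots ! nat d < 1117901"
  by (simp add: upto_rec1 link_table cross_roots_def powers_def)

lemma legendre_inner:
  assumes "d mod 25 \<noteq> 0"
  shows "legendre (1 - 424077 ^ nat (d mod 25)) = (if link False False d then 1 else - 1)"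
proof -
  let ?d = "d mod 25"
  have d: "?d \<in> set [1..24]"
    using assms mod_25_in_upto[of d] by auto
  then have "legendre (1 - powers ! nat ?d) = (if link False False ?d then 1 else - 1)"
    using inner_table by (intro legendre_witness) blast+
  moreover have "[1 - powers ! nat ?d = 1 - 424077 ^ nat ?d] (mod 1117901)"
    by (subst powers_nth) (simp_all add: cong_def mod_diff_right_eq)
  ultimately show ?thesis
    using Legendre_cong link_cong[of ?d d] by simp
qed

lemma legendre_cross:
  "legendre (1 - 243806 * 424077 ^ nat (d mod 25)) = (if link False True d then 1 else - 1)"
proof -
  let ?d = "d mod 25"
  have "legendre (1 - 243806 * powers ! nat ?d) = (if link False True ?d then 1 else - 1)"
    using cross_table mod_25_in_upto[of d] by (intro legendre_witness) blast+
  moreover have "[1 - 243806 * powers ! nat ?d = 1 - 243806 * 424077 ^ nat ?d] (mod 1117901)"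
    by (subst powers_nth, simp) (intro cong_diff cong_mult cong_refl, simp add: cong_def)
  ultimately show ?thesis
    using Legendre_cong link_cong[of ?d d] by simp
qed

lemma legendre_h: "legendre 424077 = 1"
  using legendre_witness[of 376337 True 424077] by simp

lemma legendre_h_power: "legendre (424077 ^ n) = 1"
  by (induction n) (simp_all add: legendre_1 legendre_mult legendre_h)

lemma legendre_c: "legendre 754583 = - 1"
  using legendre_witness[of 59354 False 754583] by simp

subsection \<open>The induced subgraph as a bicirculant\<close>

text \<open>
  The second coset is based at \<open>g = c h\<^sup>5\<close> rather than at \<open>c\<close>: this shift is what makes multiplication of the
  exponents by 7 compatible with adjacency.
\<close>

definition base :: "bool \<Rightarrow> int" where
  "base s = (if s then 243806 else 1)"

fun vertex :: "bool \<times> int \<Rightarrow> int" where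
  "vertex (s, i) = base s * 424077 ^ nat i mod 1117901"

lemma h_power_cong:
  assumes "a mod 25 = b mod 25"
  shows "[424077 ^ a = (424077 ^ b :: int)] (mod 1117901)"
proof -
  have "[424077 ^ n = (424077 ^ (n mod 25) :: int)] (mod 1117901)" for n :: nat
  proof -
    have "(424077::int) ^ n = 424077 ^ (25 * (n div 25) + n mod 25)"
      by simp
    also have "\<dots> = (424077 ^ 25) ^ (n div 25) * 424077 ^ (n mod 25)"
      by (simp only: power_add power_mult)
    also have "[\<dots> = 1 ^ (n div 25) * 424077 ^ (n mod 25)] (mod 1117901)"
      by (intro cong_mult cong_pow cong_refl) (simp only: cong_def h_power_25, simp)
    finally show ?thesis
      by simp
  qed
  from this[of a] this[of b] show ?thesis
    unfolding assms by (meson cong_sym cong_trans)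
qed

lemma link_True_True:
  assumes "d mod 25 \<noteq> 0"
  shows "link True True d \<longleftrightarrow> \<not> link False False d"
proof -
  have "\<forall>d \<in> set [1..24]. link True True d \<longleftrightarrow> \<not> link False False d"
    by (simp add: upto_rec1 link_table)
  moreover have "d mod 25 \<in> set [1..24]"
    using assms mod_25_in_upto[of d] by auto
  ultimately have "link True True (d mod 25) \<longleftrightarrow> \<not> link False False (d mod 25)"
    by blast
  then show ?thesis
    by (simp add: link_def)
qed

text \<open>
  Two of the four cases are tabulated. Inside the second coset the non-residue \<open>g\<close> is a common factor, which
  flips all symbols. From the second coset to the first,
  \<open>g - h\<^sup>d = - h\<^sup>d (1 - g h\<^sup>-\<^sup>d)\<close>, where \<open>- h\<^sup>d\<close> is a square.
\<close>

lemma legendre_base_diff: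
  assumes "s = t \<Longrightarrow> d mod 25 \<noteq> 0"
  shows "legendre (base s - base t * 424077 ^ nat (d mod 25)) = (if link s t d then 1 else - 1)"
proof -
  let ?h = "\<lambda>d. 424077 ^ nat (d mod 25) :: int"
  consider (FF) "\<not> s" "\<not> t" | (FT) "\<not> s" t | (TF) s "\<not> t" | (TT) s t
    by blast
  then show ?thesis
  proof cases
    case FF
    then show ?thesis
      using legendre_inner[of d] assms by (simp add: base_def)
  next
    case FT
    then show ?thesis
      using legendre_cross[of d] by (simp add: base_def)
  next
    case TF
    have "(nat (d mod 25) + nat (- d mod 25)) mod 25 = 0 mod 25"
    proof -
      have "int ((nat (d mod 25) + nat (- d mod 25)) mod 25) = (d mod 25 + - d mod 25) mod 25"
        by (simp add: zmod_int)
      also have "\<dots> = 0"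
        by (simp add: mod_add_eq)
      finally show ?thesis
        by simp
    qed
    then have "[424077 ^ (nat (d mod 25) + nat (- d mod 25)) = (424077 ^ 0 :: int)] (mod 1117901)"
      by (rule h_power_cong)
    then have inverse: "[?h d * ?h (- d) = 1] (mod 1117901)"
      by (simp add: power_add)
    have "[243806 * 1 - ?h d = 243806 * (?h d * ?h (- d)) - ?h d] (mod 1117901)"
      by (intro cong_diff cong_mult cong_refl cong_sym[OF inverse])
    also have "243806 * (?h d * ?h (- d)) - ?h d = ?h d * - (1 - 243806 * ?h (- d))"
      by (simp add: algebra_simps)
    finally have "legendre (243806 - ?h d) = legendre (?h d * - (1 - 243806 * ?h (- d)))"
      by (intro Legendre_cong) simp
    also have "\<dots> = (if link False True (- d) then 1 else - 1)"
      by (simp only: legendre_mult legendre_h_power legendre_minus legendre_cross mult_1)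
    finally show ?thesis
      using TF link_sym[of False True d] by (simp add: base_def)
  next
    case TT
    have "legendre 243806 = - 1"
      using legendre_witness[of 12029 False 243806] by simp
    moreover have "243806 - 243806 * ?h d = 243806 * (1 - ?h d)"
      by (simp add: algebra_simps)
    ultimately have "legendre (243806 - 243806 * ?h d) = - legendre (1 - ?h d)"
      by (simp only: legendre_mult)
    then show ?thesis
      using TT legendre_inner[of d] link_True_True[of d] assms by (simp add: base_def)
  qed
qed

text \<open>
  A common factor \<open>h\<^sup>i\<close> is a square, so only the difference of the exponents matters. The value is never
  0, which also yields injectivity of the labelling.
\<close>

lemma legendre_vertex_diff:
  assumes u: "u \<in> verts bicirculant" and v: "v \<in> verts bicirculant" and "u \<noteq> v"
  shows "legendre (vertex u - vertex v) = (if adj u v then 1 else - 1)"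
proof -
  obtain s i t j where uv: "u = (s, i)" "v = (t, j)"
    by (cases u, cases v)
  have ij: "0 \<le> i" "i < 25" "0 \<le> j" "j < 25"
    using u v by (simp_all add: uv verts_bicirculant)
  let ?d = "nat ((j - i) mod 25)"
  have "int (nat j mod 25) = int ((nat i + ?d) mod 25)"
    using ij by (simp add: zmod_int mod_add_right_eq)
  then have "[424077 ^ nat j = (424077 ^ (nat i + ?d) :: int)] (mod 1117901)"
    by (intro h_power_cong) simp
  then have "[base s * 424077 ^ nat i - base t * 424077 ^ nat j =
      base s * 424077 ^ nat i - base t * 424077 ^ (nat i + ?d)] (mod 1117901)"
    by (intro cong_diff cong_mult cong_refl)
  also have "base s * 424077 ^ nat i - base t * 424077 ^ (nat i + ?d) =
      424077 ^ nat i * (base s - base t * 424077 ^ ?d)"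
    by (simp add: power_add algebra_simps)
  finally have "[vertex u - vertex v = 424077 ^ nat i * (base s - base t * 424077 ^ ?d)] (mod 1117901)"
    by (simp add: uv cong_def mod_diff_eq)
  then have "legendre (vertex u - vertex v) = legendre (base s - base t * 424077 ^ ?d)"
    by (simp add: Legendre_cong legendre_mult legendre_h_power)
  moreover have "(j - i) mod 25 \<noteq> 0" if "s = t"
  proof
    assume "(j - i) mod 25 = 0"
    then have "j mod 25 = i mod 25"
      by (simp add: mod_eq_dvd_iff mod_eq_0_iff_dvd)
    with ij \<open>u \<noteq> v\<close> that show False
      by (simp add: uv)
  qed
  ultimately show ?thesis
    by (simp add: uv legendre_base_diff)
qed

lemma legendre_0: "legendre 0 = 0"
  by (simp add: Legendre_def)

lemma inj_on_vertex: "inj_on vertex (verts bicirculant)"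
proof (rule inj_onI, rule ccontr)
  fix u v assume "u \<in> verts bicirculant" "v \<in> verts bicirculant" "vertex u = vertex v" "u \<noteq> v"
  then show False
    using legendre_vertex_diff[of u v] by (simp add: legendre_0 split: if_splits)
qed

lemma not_adj_self: "\<not> adj v v"
  by (cases v) (simp add: link_not_self)

lemma paley_induced_subgraph:
  assumes "S \<subseteq> {0..<1117901}"
  shows "paley_graph (residue_ring 1117901) \<restriction> S =
    with_proj \<lparr>pverts = S, parcs = {(x, y) \<in> S \<times> S. legendre (x - y) = 1}\<rparr>"
proof -
  interpret residues_prime 1117901 "residue_ring 1117901"
    by unfold_locales (simp_all only: prime_1117901 of_nat_numeral)
  have "x \<ominus>\<^bsub>residue_ring 1117901\<^esub> y = (x - y) mod 1117901" for x y
    by (simp add: a_minus_def res_neg_eq res_add_eq mod_simps)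
  moreover have "legendre ((x - y) mod 1117901) = legendre (x - y)" for x y
    by (rule Legendre_cong) simp
  ultimately have "x \<ominus>\<^bsub>residue_ring 1117901\<^esub> y \<in> nonzero_squares (residue_ring 1117901) \<longleftrightarrow>
      legendre (x - y) = 1" for x y
    by (simp add: nonzero_squares_residue_ring)
  then have "{e. e \<in> S \<times> S \<and> e \<in> parcs \<lparr>pverts = carrier (residue_ring 1117901),
        parcs = {(x, y). x \<in> carrier (residue_ring 1117901) \<and> y \<in> carrier (residue_ring 1117901) \<and>
          x \<noteq> y \<and> x \<ominus>\<^bsub>residue_ring 1117901\<^esub> y \<in> nonzero_squares (residue_ring 1117901)}\<rparr>} =
      {(x, y) \<in> S \<times> S. legendre (x - y) = 1}"
    using assms by (auto simp: residue_ring_def legendre_0)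
  moreover have "{e. e \<in> S \<times> S \<and> P e} = {e \<in> {e. P e}. fst e \<in> S \<and> snd e \<in> S}" for P
    by auto
  ultimately show ?thesis
    by (simp add: induce_subgraph_def paley_graph_def with_proj_def)
qed

lemma vertex_graph_iso:
  defines "S \<equiv> vertex ` verts bicirculant"
  shows "graph_iso vertex bicirculant (paley_graph (residue_ring 1117901) \<restriction> S)"
    and "graph (paley_graph (residue_ring 1117901) \<restriction> S)"
proof -
  have S: "S \<subseteq> {0..<1117901}"
    by (auto simp: S_def)
  have "legendre (vertex u - vertex v) = 1 \<longleftrightarrow> adj u v"
    if "u \<in> verts bicirculant" "v \<in> verts bicirculant" for u v
    using legendre_vertex_diff[OF that] by (cases "u = v") (simp_all add: legendre_0 not_adj_self)
  then show "graph_iso vertex bicirculant (paley_graph (residue_ring 1117901) \<restriction> S)"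
    unfolding paley_induced_subgraph[OF S] graph_iso_def
    by (simp add: S_def bicirculant_adj bij_betw_imageI inj_on_vertex)
  show "graph (paley_graph (residue_ring 1117901) \<restriction> S)"
    unfolding paley_induced_subgraph[OF S]
  proof (rule graph_with_proj)
    show "finite S"
      by (simp add: S_def verts_bicirculant)
    show "x \<in> S \<and> y \<in> S \<and> x \<noteq> y \<and> (y, x) \<in> {(x, y) \<in> S \<times> S. legendre (x - y) = 1}"
      if "(x, y) \<in> {(x, y) \<in> S \<times> S. legendre (x - y) = 1}" for x y
      using that legendre_minus[of "x - y"] by (auto simp: legendre_0)
  qed
qed

lemma vertex_image_False: "vertex ` ({False} \<times> {0..<25}) = {424077 ^ i mod 1117901 | i. i \<le> 24}"
proof
  show "{424077 ^ i mod 1117901 | i. i \<le> 24} \<subseteq> vertex ` ({False} \<times> {0..<25})"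
  proof safe
    fix i :: nat assume "i \<le> 24"
    then show "424077 ^ i mod 1117901 \<in> vertex ` ({False} \<times> {0..<25})"
      by (intro image_eqI[of _ _ "(False, int i)"]) (auto simp: base_def)
  qed
  show "vertex ` ({False} \<times> {0..<25}) \<subseteq> {424077 ^ i mod 1117901 | i. i \<le> 24}"
  proof safe
    fix i :: int assume "i \<in> {0..<25}"
    then show "\<exists>n. vertex (False, i) = 424077 ^ n mod 1117901 \<and> n \<le> 24"
      by (intro exI[of _ "nat i"]) (auto simp: base_def)
  qed
qed

lemma vertex_True: "vertex (True, i) = 754583 * 424077 ^ (nat i + 5) mod 1117901"
proof -
  have "(424077::int) ^ 5 mod 1117901 = 1002325"
    using powers_nth[of 5] by (simp add: powers_def)
  then have "[754583 * 424077 ^ 5 = 754583 * 1002325] (mod (1117901::int))"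
    by (intro cong_mult cong_refl) (simp add: cong_def)
  also have "[754583 * 1002325 = 243806] (mod (1117901::int))"
    by (simp add: cong_def)
  finally have "[754583 * 424077 ^ 5 * 424077 ^ nat i = 243806 * 424077 ^ nat i] (mod (1117901::int))"
    by (intro cong_mult cong_refl)
  moreover have "754583 * 424077 ^ (nat i + 5) = 754583 * 424077 ^ 5 * (424077 ^ nat i :: int)"
    by (simp only: power_add mult_ac)
  ultimately show ?thesis
    by (simp only: vertex.simps base_def if_True cong_def)
qed

lemma vertex_image_True:
  "vertex ` ({True} \<times> {0..<25}) = {754583 * (424077 ^ i mod 1117901) mod 1117901 | i. i \<le> 24}"
proof
  show "vertex ` ({True} \<times> {0..<25}) \<subseteq> {754583 * (424077 ^ i mod 1117901) mod 1117901 | i. i \<le> 24}"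
  proof safe
    fix i :: int assume "i \<in> {0..<25}"
    have "[754583 * 424077 ^ (nat i + 5) = 754583 * (424077 ^ ((nat i + 5) mod 25) :: int)] (mod 1117901)"
      by (intro cong_mult cong_refl h_power_cong) (simp only: mod_mod_trivial)
    then have "vertex (True, i) = 754583 * (424077 ^ ((nat i + 5) mod 25) mod 1117901) mod 1117901"
      by (simp only: vertex_True cong_def mod_mult_right_eq)
    moreover have "(nat i + 5) mod 25 \<le> 24"
      using mod_less_divisor[of 25 "nat i + 5"] by linarith
    ultimately show "\<exists>n. vertex (True, i) = 754583 * (424077 ^ n mod 1117901) mod 1117901 \<and> n \<le> 24"
      by (intro exI conjI)
  qed
  show "{754583 * (424077 ^ i mod 1117901) mod 1117901 | i. i \<le> 24} \<subseteq> vertex ` ({True} \<times> {0..<25})"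
  proof safe
    fix i :: nat assume "i \<le> 24"
    let ?j = "int ((i + 20) mod 25)"
    have "((i + 20) mod 25 + 5) mod 25 = i mod 25"
      by (subst mod_add_left_eq) simp
    then have "[754583 * 424077 ^ ((i + 20) mod 25 + 5) = 754583 * (424077 ^ i :: int)] (mod 1117901)"
      by (intro cong_mult cong_refl h_power_cong)
    then have "754583 * (424077 ^ i mod 1117901) mod 1117901 = vertex (True, ?j)"
      by (simp only: vertex_True nat_int cong_def mod_mult_right_eq)
    moreover have "(True, ?j) \<in> {True} \<times> {0..<25}"
      by simp
    ultimately show "754583 * (424077 ^ i mod 1117901) mod 1117901 \<in> vertex ` ({True} \<times> {0..<25})"
      by (rule image_eqI)
  qed
qed

section \<open>The subgraph of the Paley graph\<close>

lemma (in group) subgroup_powers: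
  fixes n :: nat
  assumes x: "x \<in> carrier G" and n: "x [^] n = \<one>" "n > 0" and fin: "finite (carrier G)"
  shows "subgroup {x [^] i | i :: nat. i < n} G"
proof -
  have "x [^] i = x [^] (i mod n)" for i :: nat
  proof -
    have "x [^] i = x [^] (n * (i div n) + i mod n)"
      by simp
    also have "\<dots> = (x [^] n) [^] (i div n) \<otimes> x [^] (i mod n)"
      using x by (simp only: nat_pow_pow nat_pow_mult)
    also have "\<dots> = x [^] (i mod n)"
      using x n by simp
    finally show ?thesis .
  qed
  then have "{x [^] i | i. i \<in> (UNIV :: nat set)} = {x [^] i | i :: nat. i < n}"
    using n(2) mod_less_divisor by blast
  then have "{x [^] i | i :: nat. i < n} = generate G {x}"
    using generate_pow_on_finite_carrier[OF fin x] by simp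
  then show ?thesis
    using generate_is_subgroup[of "{x}"] x by simp
qed

theorem mainTheorem3:
  fixes p :: nat and F :: "int ring" and h c :: int and H :: "int set"
    and G :: "(int, int \<times> int) pre_digraph"
  assumes p: "p = 1117901"
    and F: "F = residue_ring (int p)"
    and h: "h = 2 [^]\<^bsub>F\<^esub> ((p - 1) div 25)"
    and H: "H = {h [^]\<^bsub>F\<^esub> i | i :: nat. i \<le> 24}"
    and c: "c = 754583"
    and G: "G = paley_graph F \<restriction> (H \<union> (c <#\<^bsub>F\<^esub> H))"
  shows "prime p \<and>
    generate (mult_of F) {2} = carrier (mult_of F) \<and>
    subgroup H (mult_of F) \<and> card H = 25 \<and>
    \<not> QuadRes (int p) c \<and>
    strongly_regular G 50 21 8 9 \<and>
    order (graph_AutoGroup G) = 100 \<and>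
    (\<exists>\<phi> \<in> hom (integer_mod_group 4) (AutoGroup (integer_mod_group 25)).
       graph_AutoGroup G \<cong>
         semidirect_product (integer_mod_group 25) (integer_mod_group 4) \<phi>)"
proof -
  have p_int: "int p = 1117901"
    by (simp only: p of_nat_numeral)
  have F': "F = residue_ring 1117901"
    by (simp only: F p_int)
  have prime_p: "prime p"
    by (simp only: p prime_1117901)
  interpret residues_prime p F
    by unfold_locales (simp_all only: prime_p F)
  interpret M: group "mult_of F"
    by (rule field_mult_group)
  have pow: "(x mod 1117901) [^]\<^bsub>F\<^esub> i = x ^ i mod 1117901" for x and i :: nat
    using pow_cong[of x i] by (simp only: p_int)

  have generate: "generate (mult_of F) {2} = carrier (mult_of F)"
    using generate_primitive_root[OF prime_1117901 _ _ primitive_root_2]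
    by (simp only: F' of_nat_numeral)

  have "(p - 1) div 25 = 44716" "(2::int) mod 1117901 = 2"
    by (simp_all add: p)
  then have "h = (2 mod 1117901) [^]\<^bsub>F\<^esub> (44716::nat)"
    by (simp only: h)
  also have "\<dots> = mod_exp 2 44716 1117901"
    by (simp only: pow mod_exp_def)
  also have "\<dots> = 424077"
    by simp
  finally have h': "h = 424077" .
  have H': "H = {424077 ^ i mod 1117901 | i. i \<le> 24}"
    using pow[of 424077] by (simp add: H h')
  have coset: "c <#\<^bsub>F\<^esub> H = {754583 * (424077 ^ i mod 1117901) mod 1117901 | i. i \<le> 24}"
    by (auto simp: l_coset_def H' c res_mult_eq p_int)

  have h_carrier: "h \<in> carrier (mult_of F)"
    by (simp add: h' res_carrier_eq res_zero_eq p)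
  have h_order: "h [^]\<^bsub>mult_of F\<^esub> (25::nat) = \<one>\<^bsub>mult_of F\<^esub>"
    using pow[of 424077 25] h_power_25 by (simp add: nat_pow_mult_of h' res_one_eq)
  have "{h [^]\<^bsub>mult_of F\<^esub> i | i :: nat. i < 25} = H"
    by (auto simp: H nat_pow_mult_of less_Suc_eq_le numeral_eq_Suc)
  moreover have "finite (carrier (mult_of F))"
    by (simp add: finite_mult_of)
  ultimately have subgroup: "subgroup H (mult_of F)"
    using M.subgroup_powers[OF h_carrier h_order] by simp

  have H_vertex: "H = vertex ` ({False} \<times> {0..<25})"
    unfolding H' vertex_image_False ..
  have "inj_on vertex ({False} \<times> {0..<25})"
    by (rule inj_on_subset[OF inj_on_vertex]) (auto simp: verts_bicirculant)
  then have card: "card H = 25"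
    unfolding H_vertex by (simp add: card_image card_cartesian_product)

  have nonresidue: "\<not> QuadRes (int p) c"
    using legendre_c by (auto simp: p_int c Legendre_def split: if_splits)

  have "H \<union> (c <#\<^bsub>F\<^esub> H) = vertex ` ({False} \<times> {0..<25} \<union> {True} \<times> {0..<25})"
    unfolding coset image_Un vertex_image_True H_vertex[symmetric] ..
  also have "{False} \<times> {0..<25} \<union> {True} \<times> {0..<25} = verts bicirculant"
    by (auto simp: verts_bicirculant)
  finally have G': "G = paley_graph (residue_ring 1117901) \<restriction> (vertex ` verts bicirculant)"
    by (simp only: G F')
  note iso = vertex_graph_iso(1)[folded G'] and graph = vertex_graph_iso(2)[folded G']

  have "strongly_regular G 50 21 8 9"
    by (rule strongly_regular_iso[OF iso graph strongly_regular_bicirculant])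
  moreover
  let ?S = "semidirect_product (integer_mod_group 25) (integer_mod_group 4) mult_by_7_power"
  have "group ?S"
    by (rule group_semidirect_product[OF _ _ mult_by_7_power_hom]) simp_all
  moreover have S_iso: "?S \<cong> graph_AutoGroup G"
    by (rule iso_trans[OF AutoGroup_bicirculant graph_AutoGroup_iso[OF iso]])
  ultimately have Aut: "graph_AutoGroup G \<cong> ?S"
    using group.iso_sym by blast
  have "order (graph_AutoGroup G) = order ?S"
    using S_iso bij_betw_same_card by (force simp: order_def is_iso_def iso_def)
  also have "\<dots> = 100"
    by (simp add: order_def semidirect_product_def carrier_integer_mod_group card_cartesian_product)
  finally have "order (graph_AutoGroup G) = 100" .
  with prime_p generate subgroup card nonresidue \<open>strongly_regular G 50 21 8 9\<close> Aut
    mult_by_7_power_hom show ?thesis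
    by blast
qed

end
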